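(* Let $\varepsilon>0$ be a constant, let $p=p(n)\in[0,1]$ satisfy $p\ge(1+\varepsilon)n^{-1/3}$, let $\mathbf{G}\sim G_{n,p}$, and let $\mathbf{X}=X^{(2)}(\mathbf{G})$. Then, w.h.p., $\mathbf{X}$ is simply connected.
   Context: $G_{n,p}$ is the binomial random graph on $[n]$. W.h.p. means with probability tending to $1$ as $n\to\infty$. For a graph $G$, $X^{(2)}(G)$ is the 2-dimensional clique complex of $G$: the simplicial complex whose faces are the vertices, edges and triangles of $G$. Simply connected means connected with trivial fundamental group (equivalently, the 1-skeleton is connected and every cycle in the 1-skeleton is contractible in the complex). *)

theory Defs
  imports "HOL-Probability.Probability"
begin

(* The binomial random graph: a simple graph on {1..n} is given by its edge set, a set of
   two-element subsets of {1..n}. *)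

definition vertex_pairs :: "nat \<Rightarrow> nat set set" where
  "vertex_pairs n = {e. e \<subseteq> {1..n} \<and> card e = 2}"

definition Gnp :: "nat \<Rightarrow> real \<Rightarrow> nat set set pmf" where
  "Gnp n p = map_pmf (\<lambda>present. {e \<in> vertex_pairs n. present e})
               (Pi_pmf (vertex_pairs n) False (\<lambda>_. bernoulli_pmf p))"

(* The abstract simplicial complex whose faces are the vertices, edges and triangles of the
   graph with vertex set V and edge set E; the empty set is not counted as a face. *)

definition clique_complex_2 :: "'a set \<Rightarrow> 'a set set \<Rightarrow> 'a set set" where
  "clique_complex_2 V E =
     {\<sigma>. \<sigma> \<subseteq> V \<and> \<sigma> \<noteq> {} \<and> finite \<sigma> \<and> card \<sigma> \<le> 3 \<and>
          (\<forall>u\<in>\<sigma>. \<forall>v\<in>\<sigma>. u \<noteq> v \<longrightarrow> {u, v} \<in> E)}"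

(* The geometric realization of an abstract simplicial complex K in barycentric coordinates:
   convex weights on the vertices whose support is a face. As a subset of the function type it
   carries the subspace topology of the product topology; for finitely many vertices this is the
   Euclidean topology, hence the usual topology of the realization. *)

definition geometric_realization :: "'a set set \<Rightarrow> ('a \<Rightarrow> real) set" where
  "geometric_realization K =
     {x. (\<forall>v. 0 \<le> x v) \<and> {v. x v \<noteq> 0} \<in> K \<and> (\<Sum>v | x v \<noteq> 0. x v) = 1}"

(* The library predicate simply_connected (any two loops are freely homotopic) amounts to
   path-connectedness and triviality of the fundamental group, except that it also holds for the
   empty space. The latter is the realization only if n = 0. *)

definition simply_connected_complex :: "'a set set \<Rightarrow> bool" where
  "simply_connected_complex K \<longleftrightarrow> simply_connected (geometric_realization K)"

end

theory Submission
  imports Defs "HOL-Real_Asymp.Real_Asymp"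
begin

text \<open>Write \<open>c = 1 + \<epsilon>\<close>. In the clique complex, the common link of two vertices
\<open>b\<close> and \<open>w\<close> is the random graph on their common neighbours. It has about
\<open>n p\<^sup>2\<close> vertices and hence average degree about
\<open>n p\<^sup>3 \<ge> c\<^sup>3 > 1\<close>; this is where the threshold comes from. A supercritical
graph joins two prescribed vertices \<open>a\<close> and \<open>c\<close> with a probability that is not too
small, and a path from \<open>a\<close> to \<open>c\<close> in the common link of \<open>b\<close> and
\<open>w\<close>, coned off at \<open>b\<close> and at \<open>w\<close>, is a disc bounded by the square
\<open>a b c w\<close>.

So a square \<open>a b c d\<close> is filled as soon as some common neighbour \<open>w\<close> of
\<open>a\<close> and \<open>c\<close> allows such a disc both for \<open>b, w\<close> and for
\<open>d, w\<close> (\<open>square_contractible\<close>). There are at least about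
\<open>n\<^bsup>1/3\<^esup>\<close> candidates for \<open>w\<close>. If
\<open>p = c n\<^bsup>-1/3\<^esup>\<close>, the links for \<open>n\<^bsup>1/4\<^esup>\<close> of them can
be made disjoint at negligible cost, which makes the attempts independent; each succeeds with probability at
least a constant times \<open>(ln n)\<^sup>-\<^sup>4\<close>, so that all of them fail with probability much
smaller than \<open>n\<^sup>-\<^sup>4\<close> (\<open>prob_not_fills_square\<close>). Hence with high
probability all squares are contractible at once. Pentagons split into triangles and squares by two adjacent
vertices, one in each of two common neighbourhoods (\<open>prob_not_splits_pentagon\<close>), and since any
two vertices have a common neighbour, every closed edge path reduces to triangles, squares and pentagons
(\<open>clique_complex_simply_connected\<close>).

Simple connectivity is not monotone in the edge set, but the two events above are increasing, and they are
stated for all tuples of vertices without reference to the edges of the square or pentagon itself. The union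
bound over tuples therefore reduces the claim to the single edge probability
\<open>c n\<^bsup>-1/3\<^esup>\<close>.

The success probability of a single attempt comes from the second moment of the number of paths of length
about \<open>log\<^sub>c n\<close> (\<open>prob_joined_through\<close>). The passage from edge paths to loops
in the realization covers the realization by open stars of vertices and uses the Lebesgue number lemma
(\<open>realization_simply_connected\<close>).\<close>

section \<open>Edge paths up to homotopy\<close>

definition edge_path :: "'a set set \<Rightarrow> 'a list \<Rightarrow> bool" where
  "edge_path K xs \<longleftrightarrow> xs \<noteq> [] \<and> (\<forall>v\<in>set xs. {v} \<in> K) \<and> successively (\<lambda>u v. {u, v} \<in> K) xs"

text \<open>The moves of the edge path groupoid. Backtracking \<open>u, v, u\<close> is covered by the triangle move for
the degenerate face \<open>{u, v, u}\<close> followed by a stutter move.\<close>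

inductive edge_homotopic :: "'a set set \<Rightarrow> 'a list \<Rightarrow> 'a list \<Rightarrow> bool" for K where
  edge_homotopic_refl: "edge_homotopic K xs xs"
| edge_homotopic_sym: "edge_homotopic K xs ys \<Longrightarrow> edge_homotopic K ys xs"
| edge_homotopic_trans: "edge_homotopic K xs ys \<Longrightarrow> edge_homotopic K ys zs \<Longrightarrow> edge_homotopic K xs zs"
| edge_homotopic_triangle: "{u, v, w} \<in> K \<Longrightarrow> edge_homotopic K (xs @ u # v # w # ys) (xs @ u # w # ys)"
| edge_homotopic_stutter: "{u} \<in> K \<Longrightarrow> edge_homotopic K (xs @ u # u # ys) (xs @ u # ys)"

lemma edge_homotopic_context:
  assumes "edge_homotopic K xs ys"
  shows "edge_homotopic K (us @ xs @ vs) (us @ ys @ vs)"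
  using assms
proof induction
  case (edge_homotopic_triangle u v w xs ys)
  show ?case
    using edge_homotopic.edge_homotopic_triangle[OF edge_homotopic_triangle, of "us @ xs" "ys @ vs"] by simp
next
  case (edge_homotopic_stutter u xs ys)
  show ?case
    using edge_homotopic.edge_homotopic_stutter[OF edge_homotopic_stutter, of "us @ xs" "ys @ vs"] by simp
qed (blast intro: edge_homotopic.intros)+

section \<open>The realization as a subset of a normed space\<close>

lemma continuous_apply_bcontfun: "continuous_on S (\<lambda>y. apply_bcontfun y v)"
  unfolding continuous_on_iff by (meson dist_bounded order_le_less_trans)

locale finite_complex =
  fixes K :: "'a::discrete_topology set set"
  assumes face_finite: "\<sigma> \<in> K \<Longrightarrow> finite \<sigma>"
    and face_nonempty: "\<sigma> \<in> K \<Longrightarrow> \<sigma> \<noteq> {}"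
    and subface: "\<sigma> \<in> K \<Longrightarrow> \<tau> \<subseteq> \<sigma> \<Longrightarrow> \<tau> \<noteq> {} \<Longrightarrow> \<tau> \<in> K"
    and finite_vertices: "finite (\<Union>K)"
begin

lemma edge_homotopic_edge_path:
  assumes "edge_homotopic K xs ys"
  shows "edge_path K xs \<longleftrightarrow> edge_path K ys"
  using assms
proof induction
  case (edge_homotopic_triangle u v w xs ys)
  then have "{u,v} \<in> K" "{v,w} \<in> K" "{u,w} \<in> K" "{u} \<in> K" "{v} \<in> K" "{w} \<in> K"
    by (auto intro: subface[OF edge_homotopic_triangle])
  then show ?case
    by (auto simp: edge_path_def successively_append_iff successively_Cons)
next
  case (edge_homotopic_stutter u xs ys)
  then show ?case
    by (auto simp: edge_path_def successively_append_iff successively_Cons)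
qed auto

text \<open>Barycentric coordinates are kept as bounded functions on the discrete vertex set: these form a normed space,
where line segments, subpaths and the groupoid laws for paths are at hand.\<close>

definition closed_simplex :: "'a set \<Rightarrow> ('a \<Rightarrow>\<^sub>C real) set" where
  "closed_simplex \<sigma> = {y. (\<forall>v. 0 \<le> apply_bcontfun y v) \<and> (\<forall>v. v \<notin> \<sigma> \<longrightarrow> apply_bcontfun y v = 0) \<and>
                   (\<Sum>v\<in>\<sigma>. apply_bcontfun y v) = 1}"

definition realization :: "('a \<Rightarrow>\<^sub>C real) set" where
  "realization = (\<Union>\<sigma>\<in>K. closed_simplex \<sigma>)"

definition vertex :: "'a \<Rightarrow> ('a \<Rightarrow>\<^sub>C real)" where
  "vertex v = Bcontfun (\<lambda>u. if u = v then 1 else 0)"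

lemma apply_vertex: "apply_bcontfun (vertex v) u = (if u = v then 1 else 0)"
proof -
  have "(\<lambda>u. if u = v then 1 else 0 :: real) \<in> bcontfun"
    by (rule bcontfun_normI[of _ 1]) auto
  then show ?thesis
    by (simp add: vertex_def Bcontfun_inverse)
qed

lemma convex_simplex: "convex (closed_simplex \<sigma>)"
  unfolding convex_def closed_simplex_def
  by (auto simp: plus_bcontfun.rep_eq scaleR_bcontfun.rep_eq sum.distrib simp flip: sum_distrib_left)

lemma vertex_in_simplex:
  assumes "v \<in> \<sigma>" "finite \<sigma>"
  shows "vertex v \<in> closed_simplex \<sigma>"
  using assms by (auto simp: closed_simplex_def apply_vertex)

lemma closed_simplex_subset_realization: "\<sigma> \<in> K \<Longrightarrow> closed_simplex \<sigma> \<subseteq> realization"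
  by (auto simp: realization_def)

lemma support_simplex:
  assumes "y \<in> closed_simplex \<sigma>" "\<sigma> \<in> K"
  shows "{v. apply_bcontfun y v \<noteq> 0} \<in> K" "y \<in> closed_simplex {v. apply_bcontfun y v \<noteq> 0}"
proof -
  let ?s = "{v. apply_bcontfun y v \<noteq> 0}"
  have sub: "?s \<subseteq> \<sigma>" using assms(1) by (auto simp: closed_simplex_def)
  have "?s \<noteq> {}"
  proof
    assume "?s = {}"
    then have "(\<Sum>v\<in>\<sigma>. apply_bcontfun y v) = 0" by (intro sum.neutral) auto
    then show False using assms(1) by (simp add: closed_simplex_def)
  qed
  then show "?s \<in> K" using subface[OF assms(2) sub] by blast
  have "(\<Sum>v\<in>?s. apply_bcontfun y v) = (\<Sum>v\<in>\<sigma>. apply_bcontfun y v)"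
    by (rule sum.mono_neutral_left) (use sub face_finite[OF assms(2)] in auto)
  then show "y \<in> closed_simplex ?s"
    using assms(1) by (auto simp: closed_simplex_def)
qed

lemma realization_iff: "y \<in> realization \<longleftrightarrow> apply_bcontfun y \<in> geometric_realization K"
proof
  assume "y \<in> realization"
  then obtain \<sigma> where s: "\<sigma> \<in> K" "y \<in> closed_simplex \<sigma>" by (auto simp: realization_def)
  from support_simplex[OF s(2,1)] show "apply_bcontfun y \<in> geometric_realization K"
    by (auto simp: geometric_realization_def closed_simplex_def)
next
  assume "apply_bcontfun y \<in> geometric_realization K"
  then show "y \<in> realization"
    by (auto simp: geometric_realization_def closed_simplex_def realization_def
             intro!: bexI[of _ "{v. apply_bcontfun y v \<noteq> 0}"])
qed

abbreviation hom (infix "\<simeq>" 50) where "p \<simeq> q \<equiv> homotopic_paths realization p q"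

text \<open>Simplices are convex, so the straight-line homotopy stays inside.\<close>

lemma hom_in_simplex:
  assumes "\<sigma> \<in> K" "path p" "path q" "pathstart p = pathstart q" "pathfinish p = pathfinish q"
    and "path_image p \<subseteq> closed_simplex \<sigma>" "path_image q \<subseteq> closed_simplex \<sigma>"
  shows "p \<simeq> q"
proof (rule homotopic_paths_linear)
  fix t :: real assume t: "t \<in> {0..1}"
  have "p t \<in> closed_simplex \<sigma>" "q t \<in> closed_simplex \<sigma>"
    using assms(6,7) t by (auto simp: path_image_def)
  then show "closed_segment (p t) (q t) \<subseteq> realization"
    using convex_simplex[of \<sigma>] closed_simplex_subset_realization[OF assms(1)]
    by (meson closed_segment_subset order_trans)
qed (use assms in auto)

lemma linepath_in_simplex: "x \<in> closed_simplex \<sigma> \<Longrightarrow> y \<in> closed_simplex \<sigma> \<Longrightarrow> path_image (linepath x y) \<subseteq> closed_simplex \<sigma>"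
  by (simp add: closed_segment_subset convex_simplex)

lemma hom_triangle:
  assumes "\<sigma> \<in> K" "x \<in> closed_simplex \<sigma>" "y \<in> closed_simplex \<sigma>" "z \<in> closed_simplex \<sigma>"
  shows "linepath x y +++ linepath y z \<simeq> linepath x z"
  by (rule hom_in_simplex[OF assms(1)])
     (use assms linepath_in_simplex in \<open>auto simp: path_image_join intro!: subset_path_image_join\<close>)

abbreviation edge :: "'a \<Rightarrow> 'a \<Rightarrow> real \<Rightarrow> ('a \<Rightarrow>\<^sub>C real)" where
  "edge u v \<equiv> linepath (vertex u) (vertex v)"

fun walk :: "'a list \<Rightarrow> real \<Rightarrow> ('a \<Rightarrow>\<^sub>C real)" where
  "walk [] = linepath 0 0"
| "walk [v] = edge v v"
| "walk (u # v # vs) = edge u v +++ walk (v # vs)"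

lemma edge_in_realization: "{u, v} \<in> K \<Longrightarrow> path_image (edge u v) \<subseteq> realization"
  using linepath_in_simplex[of "vertex u" "{u,v}" "vertex v"] closed_simplex_subset_realization[of "{u,v}"]
  by (auto simp: vertex_in_simplex)

lemma pathstart_walk [simp]: "xs \<noteq> [] \<Longrightarrow> pathstart (walk xs) = vertex (hd xs)"
  by (induction xs rule: walk.induct) auto

lemma pathfinish_walk [simp]: "xs \<noteq> [] \<Longrightarrow> pathfinish (walk xs) = vertex (last xs)"
  by (induction xs rule: walk.induct) auto

lemma edge_path_Cons: "edge_path K (u # v # vs) \<longleftrightarrow> {u} \<in> K \<and> {u, v} \<in> K \<and> edge_path K (v # vs)"
  by (auto simp: edge_path_def)

lemma path_walk: "path (walk xs)"
proof (induction xs rule: walk.induct)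
  case (3 u v vs)
  then show ?case by (simp add: path_join_imp)
qed (simp_all only: walk.simps path_linepath)

lemma walk_in_realization: "edge_path K xs \<Longrightarrow> path_image (walk xs) \<subseteq> realization"
proof (induction xs rule: walk.induct)
  case (2 v)
  then show ?case using edge_in_realization[of v v] by (simp add: edge_path_def)
next
  case (3 u v vs)
  then have "path_image (edge u v) \<subseteq> realization" "path_image (walk (v # vs)) \<subseteq> realization"
    using edge_in_realization by (auto simp: edge_path_Cons)
  then show ?case by (simp add: subset_path_image_join)
qed (auto simp: edge_path_def)

lemma hom_join_cong:
  assumes "p \<simeq> p'" "q \<simeq> q'" "pathfinish p = pathstart q"
  shows "p +++ q \<simeq> p' +++ q'"
  using homotopic_paths_join assms by blast

lemma walk_stutter:
  assumes "edge_path K (u # ys)"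
  shows "walk (u # u # ys) \<simeq> walk (u # ys)"
  by (simp add: homotopic_paths_lid' path_walk walk_in_realization[OF assms])

lemma walk_triangle:
  assumes "{u, v, w} \<in> K" "edge_path K (w # ys)"
  shows "walk (u # v # w # ys) \<simeq> walk (u # w # ys)"
proof -
  have e: "{u, v} \<in> K" "{v, w} \<in> K" "{u,w} \<in> K" by (auto intro: subface[OF assms(1)])
  have "edge u v +++ (edge v w +++ walk (w # ys)) \<simeq> (edge u v +++ edge v w) +++ walk (w # ys)"
    by (rule homotopic_paths_assoc)
      (use e edge_in_realization walk_in_realization[OF assms(2)] path_walk in auto)
  also have "\<dots> \<simeq> edge u w +++ walk (w # ys)"
    by (rule hom_join_cong)
       (auto intro!: hom_triangle[OF assms(1)] vertex_in_simplex walk_in_realization[OF assms(2)] path_walk)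
  finally show ?thesis by simp
qed

lemma walk_prefix_cong:
  assumes "walk (u # ys) \<simeq> walk (u # zs)" "edge_path K (xs @ u # ys)"
  shows "walk (xs @ u # ys) \<simeq> walk (xs @ u # zs)"
  using assms(2)
proof (induction xs rule: walk.induct)
  case 1
  then show ?case using assms(1) by simp
next
  case (2 v)
  then have "path_image (edge v u) \<subseteq> realization" by (intro edge_in_realization) (auto simp: edge_path_Cons)
  then show ?case using assms(1) by (auto intro!: hom_join_cong)
next
  case (3 x y vs)
  then have "path_image (edge x y) \<subseteq> realization" by (intro edge_in_realization) (auto simp: edge_path_Cons)
  with 3 show ?case by (auto intro!: hom_join_cong simp: edge_path_Cons)
qed

lemma edge_path_suffix: "edge_path K (xs @ u # ys) \<Longrightarrow> edge_path K (u # ys)"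
  by (auto simp: edge_path_def successively_append_iff)

lemma edge_homotopic_imp_hom:
  assumes "edge_homotopic K xs ys" "edge_path K xs"
  shows "walk xs \<simeq> walk ys"
  using assms
proof induction
  case (edge_homotopic_refl xs)
  then show ?case by (simp add: path_walk walk_in_realization)
next
  case (edge_homotopic_sym xs ys)
  then show ?case using edge_homotopic_edge_path homotopic_paths_sym by blast
next
  case (edge_homotopic_trans xs ys zs)
  then show ?case using edge_homotopic_edge_path homotopic_paths_trans by blast
next
  case (edge_homotopic_triangle u v w xs ys)
  then have "edge_path K (w # ys)"
    using edge_path_suffix[of "xs @ [u,v]" w ys] by simp
  then show ?case
    using walk_prefix_cong[OF walk_triangle, of u v w ys xs] edge_homotopic_triangle by simp
next
  case (edge_homotopic_stutter u xs ys)
  then have "edge_path K (u # ys)"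
    using edge_path_suffix[of "xs @ [u]" u ys] by simp
  then show ?case
    using walk_prefix_cong[OF walk_stutter, of u ys xs] edge_homotopic_stutter by simp
qed

lemma edge_path_snoc:
  "xs \<noteq> [] \<Longrightarrow> edge_path K (xs @ [v]) \<longleftrightarrow> edge_path K xs \<and> {last xs, v} \<in> K \<and> {v} \<in> K"
  unfolding edge_path_def successively_append_iff by auto

lemma walk_snoc:
  assumes "edge_path K (xs @ [v])" "xs \<noteq> []"
  shows "walk (xs @ [v]) \<simeq> walk xs +++ edge (last xs) v"
  using assms
proof (induction xs rule: walk.induct)
  case (2 u)
  then have uv: "{u, v} \<in> K" and u: "{u} \<in> K" and v: "{v} \<in> K" by (auto simp: edge_path_def)
  have "edge u v +++ edge v v \<simeq> edge u v"
    by (rule hom_triangle[OF uv]) (auto intro: vertex_in_simplex)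
  also have "edge u v \<simeq> edge u u +++ edge u v"
    by (rule homotopic_paths_sym, rule hom_triangle[OF uv]) (auto intro: vertex_in_simplex)
  finally show ?case by (simp only: walk.simps append.simps last.simps simp_thms if_True)
next
  case (3 x y vs)
  then have xy: "path_image (edge x y) \<subseteq> realization" by (intro edge_in_realization) (auto simp: edge_path_Cons)
  have ep: "edge_path K ((y # vs) @ [v])" using 3(2) by (auto simp: edge_path_Cons)
  then have "edge_path K (y # vs)" "{last (y # vs), v} \<in> K"
    using edge_path_snoc[of "y # vs" v] by blast+
  then have i: "path_image (walk (y # vs)) \<subseteq> realization" "path_image (edge (last (y#vs)) v) \<subseteq> realization"
    using walk_in_realization edge_in_realization by blast+
  have "edge x y +++ walk ((y # vs) @ [v]) \<simeq> edge x y +++ (walk (y # vs) +++ edge (last (y # vs)) v)"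
    using xy by (intro hom_join_cong 3(1)[OF ep]) auto
  also have "\<dots> \<simeq> (edge x y +++ walk (y # vs)) +++ edge (last (y # vs)) v"
    by (rule homotopic_paths_assoc) (use xy i path_walk in auto)
  finally show ?case by simp
qed auto

section \<open>Loops in the realization\<close>

definition star :: "'a \<Rightarrow> ('a \<Rightarrow>\<^sub>C real) set" where
  "star v = {y \<in> realization. apply_bcontfun y v > 0}"

lemma star_simplex:
  assumes "y \<in> star v"
  obtains \<sigma> where "\<sigma> \<in> K" "v \<in> \<sigma>" "y \<in> closed_simplex \<sigma>" "vertex v \<in> closed_simplex \<sigma>"
proof -
  from assms obtain \<sigma> where s: "\<sigma> \<in> K" "y \<in> closed_simplex \<sigma>" and y: "apply_bcontfun y v > 0"
    by (auto simp: star_def realization_def)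
  then have "v \<in> \<sigma>" by (auto simp: closed_simplex_def)
  with s that show ?thesis using vertex_in_simplex face_finite by blast
qed

text \<open>The star is star-shaped around the vertex: together with the vertex, the path spans a cone inside the
realization. Parametrizing the cone by the unit square turns the claim into a homotopy of paths in the square.\<close>

lemma star_cone:
  assumes "path p" "path_image p \<subseteq> star v"
  shows "linepath (vertex v) (pathstart p) +++ p \<simeq> linepath (vertex v) (pathfinish p)"
proof -
  define c where "c = (\<lambda>(m::real, t::real). (1 - m) *\<^sub>R vertex v + m *\<^sub>R p t)"
  have cont_p: "continuous_on {0..1} p" using assms(1) by (simp add: path_def)
  have cin: "c (m, t) \<in> realization" if "m \<in> {0..1}" "t \<in> {0..1}" for m t
  proof -
    have "p t \<in> star v" using assms(2) that by (auto simp: path_image_def)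
    then obtain \<sigma> where s: "\<sigma> \<in> K" "p t \<in> closed_simplex \<sigma>" "vertex v \<in> closed_simplex \<sigma>"
      by (rule star_simplex)
    then have "c (m, t) \<in> closed_simplex \<sigma>"
      using that convex_simplex[of \<sigma>] by (auto simp: c_def convex_alt)
    then show ?thesis using closed_simplex_subset_realization s by blast
  qed
  \<comment> \<open>Of the two ways along the boundary of the square from (0,0) to (1,1), the map \<open>c\<close> carries one to the
    left-hand side, the other to a constant path followed by the right-hand side.\<close>
  have contc: "continuous_on ({0..1} \<times> {0..1}) c"
    unfolding c_def case_prod_unfold
    by (intro continuous_intros continuous_on_compose2[OF cont_p]) auto
  have sq: "convex ({0..1::real} \<times> {0..1::real})"
    by (intro convex_Times) auto
  let ?Q = "{0..1::real} \<times> {0..1::real}"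
  have cstart: "c (0, s) = vertex v" for s by (simp add: c_def)
  have hQ: "homotopic_paths ?Q (linepath (0,0) (1,0) +++ linepath (1,0) (1,1)) (linepath (0,0) (0,1) +++ linepath (0,1) (1::real,1::real))"
  proof (rule homotopic_paths_linear)
    fix t :: real assume t: "t \<in> {0..1}"
    have "path_image (linepath (0,0) (1,0) +++ linepath (1,0) (1,1)) \<subseteq> ?Q"
      "path_image (linepath (0,0) (0,1) +++ linepath (0,1) (1,1)) \<subseteq> ?Q"
      by (intro subset_path_image_join; simp add: closed_segment_subset sq)+
    then show "closed_segment ((linepath (0,0) (1,0) +++ linepath (1,0) (1,1)) t) ((linepath (0,0) (0,1) +++ linepath (0,1) (1,1)) t) \<subseteq> ?Q"
      using t by (intro closed_segment_subset sq) (auto simp: path_image_def)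
  qed auto
  have h: "c \<circ> (linepath (0,0) (1,0) +++ linepath (1,0) (1,1)) \<simeq> c \<circ> (linepath (0,0) (0,1) +++ linepath (0,1) (1,1))"
    by (rule homotopic_paths_continuous_image[OF hQ contc]) (use cin in auto)
  have e1: "c \<circ> linepath (0,0) (1,0) = linepath (vertex v) (pathstart p)"
    by (auto simp: c_def linepath_def pathstart_def fun_eq_iff)
  have e2: "c \<circ> linepath (1,0) (1,1) = p"
    by (auto simp: c_def linepath_def fun_eq_iff)
  have e3: "c \<circ> linepath (0,0) (0,1) = linepath (vertex v) (vertex v)"
    by (auto simp: c_def linepath_def fun_eq_iff algebra_simps)
  have e4: "c \<circ> linepath (0,1) (1,1) = linepath (vertex v) (pathfinish p)"
    by (auto simp: c_def linepath_def pathfinish_def fun_eq_iff)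
  have "linepath (vertex v) (pathstart p) +++ p \<simeq> edge v v +++ linepath (vertex v) (pathfinish p)"
    using h by (simp add: path_compose_join e1 e2 e3 e4)
  also have "\<dots> \<simeq> linepath (vertex v) (pathfinish p)"
  proof -
    have "pathfinish p \<in> star v" using assms by auto
    then obtain \<sigma> where s: "\<sigma> \<in> K" "pathfinish p \<in> closed_simplex \<sigma>" "vertex v \<in> closed_simplex \<sigma>"
      by (rule star_simplex)
    then show ?thesis using hom_triangle by blast
  qed
  finally show ?thesis .
qed

text \<open>The open stars of the vertices cover the realization, so the Lebesgue number lemma applies.\<close>

lemma path_star_subdivision:
  assumes "path g" "path_image g \<subseteq> realization"
  obtains N :: nat where "N > 0"
    "\<And>i. i < N \<Longrightarrow> \<exists>v. g ` {real i / real N..real (Suc i) / real N} \<subseteq> star v"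
proof -
  have cg: "continuous_on {0..1} g" using assms by (simp add: path_def)
  have cv: "continuous_on {0..1} (\<lambda>t. apply_bcontfun (g t) v)" for v
    using continuous_on_compose2[OF continuous_apply_bcontfun cg] by blast
  have "\<exists>U. open U \<and> U \<inter> {0..1} = {t\<in>{0..1}. g t \<in> star v}" for v
  proof -
    have "{t\<in>{0..1}. g t \<in> star v} = {0..1} \<inter> (\<lambda>t. apply_bcontfun (g t) v) -` {0<..}"
      using assms(2) by (auto simp: star_def path_image_def)
    moreover have "\<exists>U. open U \<and> U \<inter> {0..1} = (\<lambda>t. apply_bcontfun (g t) v) -` {0<..} \<inter> {0..1}"
      using cv[of v] unfolding continuous_on_open_invariant by (metis open_greaterThan)
    ultimately show ?thesis by (metis Int_commute)
  qed
  then obtain U where U: "\<And>v. open (U v)" "\<And>v. U v \<inter> {0..1} = {t\<in>{0..1}. g t \<in> star v}"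
    by metis
  have "{0..1} \<subseteq> \<Union>(range U)"
  proof
    fix t :: real assume t: "t \<in> {0..1}"
    then have "g t \<in> realization" using assms(2) by (auto simp: path_image_def)
    then obtain \<sigma> where s: "\<sigma> \<in> K" "g t \<in> closed_simplex \<sigma>" by (auto simp: realization_def)
    from support_simplex(1)[OF s(2,1)] face_nonempty obtain v where "apply_bcontfun (g t) v \<noteq> 0"
      by blast
    then have "g t \<in> star v" using s \<open>g t \<in> realization\<close>
      by (auto simp: star_def closed_simplex_def order_less_le)
    then show "t \<in> \<Union>(range U)" using U(2)[of v] t by auto
  qed
  then have "\<exists>\<delta>>0. \<forall>T. T \<subseteq> {0..1} \<longrightarrow> diameter T < \<delta> \<longrightarrow> (\<exists>B\<in>range U. T \<subseteq> B)"
    by (rule Lebesgue_number_lemma[OF compact_Icc[of "0::real" 1] _ _ , rotated])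
      (use U(1) in blast)+
  then obtain \<delta> where d: "0 < \<delta>" "\<And>T. T \<subseteq> {0..1} \<Longrightarrow> diameter T < \<delta> \<Longrightarrow> \<exists>B\<in>range U. T \<subseteq> B"
    by blast
  obtain M :: nat where M: "inverse (real (Suc M)) < \<delta>"
    using reals_Archimedean[OF d(1)] by blast
  show ?thesis
  proof (rule that[of "Suc M"])
    fix i assume i: "i < Suc M"
    let ?T = "{real i / real (Suc M)..real (Suc i) / real (Suc M)}"
    have le: "real i / real (Suc M) \<le> real (Suc i) / real (Suc M)" by (simp add: divide_right_mono)
    have sub: "?T \<subseteq> {0..1}" using i by (auto simp: field_simps intro: order_trans)
    have "diameter ?T = real (Suc i) / real (Suc M) - real i / real (Suc M)"
      using le by (simp add: diameter_closed_interval)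
    also have "\<dots> = inverse (real (Suc M))" by (simp add: field_simps)
    finally have "diameter ?T < \<delta>" using M by simp
    then obtain v where "?T \<subseteq> U v" using d(2)[OF sub] by auto
    then show "\<exists>v. g ` ?T \<subseteq> star v"
      using U(2)[of v] sub by (intro exI[of _ v]) blast
  qed auto
qed

text \<open>The paths \<open>T v\<close> give every point \<open>x\<close> a homotopy class of paths from the root to
\<open>x\<close>: go along \<open>T v\<close> to a vertex \<open>v\<close> whose open star contains
\<open>x\<close>, then straight to \<open>x\<close>. The assumption on edges makes the class independent of
\<open>v\<close>. Following a path inside one open star carries the class of its start to the class of its
end, and by subdivision this holds for every path. A loop therefore fixes the class of its base point, which
makes the loop trivial.\<close>

lemma realization_simply_connected:
  assumes T: "\<And>v. {v} \<in> K \<Longrightarrow> edge_path K (T v) \<and> hd (T v) = r \<and> last (T v) = v"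
    and cone: "\<And>u v. {u, v} \<in> K \<Longrightarrow> edge_homotopic K (T u @ [v]) (T v)"
  shows "simply_connected realization"
proof -
  define approach where "approach v x = walk (T v) +++ linepath (vertex v) x" for v x
  have vK: "{v} \<in> K" if "x \<in> star v" for x v
  proof -
    from that obtain \<sigma> where "\<sigma> \<in> K" "v \<in> \<sigma>" by (rule star_simplex)
    then show ?thesis by (auto intro: subface)
  qed
  have lin: "path_image (linepath (vertex v) x) \<subseteq> realization" if "x \<in> star v" for x v
  proof -
    from that obtain \<sigma> where s: "\<sigma> \<in> K" "v \<in> \<sigma>" "x \<in> closed_simplex \<sigma>" "vertex v \<in> closed_simplex \<sigma>"
      by (rule star_simplex)
    then show ?thesis using linepath_in_simplex closed_simplex_subset_realization by blast
  qed
  have wlk: "path_image (walk (T v)) \<subseteq> realization" "pathstart (walk (T v)) = vertex r"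
    "pathfinish (walk (T v)) = vertex v" if "{v} \<in> K" for v
    using T[OF that] walk_in_realization by (auto simp: edge_path_def)
  have app: "path (approach v x)" "path_image (approach v x) \<subseteq> realization"
    "pathstart (approach v x) = vertex r" "pathfinish (approach v x) = x" if "x \<in> star v" for x v
    using wlk[OF vK[OF that]] lin[OF that] path_walk
    unfolding approach_def
    by (simp_all add: path_image_join del: path_image_linepath)
  have indep: "approach u x \<simeq> approach v x" if "x \<in> star u" "x \<in> star v" for x u v
  proof -
    from that(1) obtain \<sigma> where s: "\<sigma> \<in> K" "u \<in> \<sigma>" "x \<in> closed_simplex \<sigma>" by (rule star_simplex)
    have "v \<in> \<sigma>" using that(2) s(3) by (auto simp: star_def closed_simplex_def)
    then have uv: "{u, v} \<in> K" using s by (intro subface[OF s(1)]) auto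
    have vs: "vertex u \<in> closed_simplex \<sigma>" "vertex v \<in> closed_simplex \<sigma>"
      using s \<open>v \<in> \<sigma>\<close> face_finite vertex_in_simplex by blast+
    note wu = wlk[OF vK[OF that(1)]] and wv = wlk[OF vK[OF that(2)]]
    have ep: "edge_path K (T u @ [v])"
      using edge_homotopic_edge_path[OF cone[OF uv]] T[OF vK[OF that(2)]] by blast
    have "walk (T v) \<simeq> walk (T u @ [v])"
      using edge_homotopic_imp_hom[OF cone[OF uv] ep] by (rule homotopic_paths_sym)
    also have "\<dots> \<simeq> walk (T u) +++ edge (last (T u)) v"
      by (rule walk_snoc[OF ep]) (use T[OF vK[OF that(1)]] in \<open>auto simp: edge_path_def\<close>)
    also have "last (T u) = u" using T[OF vK[OF that(1)]] by blast
    finally have "approach v x \<simeq> (walk (T u) +++ edge u v) +++ linepath (vertex v) x"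
      unfolding approach_def by (rule hom_join_cong) (use wv lin[OF that(2)] in auto)
    also have "\<dots> \<simeq> walk (T u) +++ (edge u v +++ linepath (vertex v) x)"
      by (rule homotopic_paths_sym, rule homotopic_paths_assoc)
         (use wu lin that edge_in_realization uv path_walk in auto)
    also have "\<dots> \<simeq> walk (T u) +++ linepath (vertex u) x"
      by (rule hom_join_cong) (use wu s vs path_walk hom_triangle in auto)
    finally show ?thesis unfolding approach_def by (rule homotopic_paths_sym)
  qed
  have step: "approach v (pathstart p) +++ p \<simeq> approach v (pathfinish p)"
    if "path p" "path_image p \<subseteq> star v" for p v
  proof -
    have ss: "pathstart p \<in> star v" "pathfinish p \<in> star v" using that by auto
    note wv = wlk[OF vK[OF ss(1)]]
    have pr: "path_image p \<subseteq> realization" using that(2) by (auto simp: star_def)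
    have "approach v (pathstart p) +++ p \<simeq> walk (T v) +++ (linepath (vertex v) (pathstart p) +++ p)"
      unfolding approach_def
      by (rule homotopic_paths_sym, rule homotopic_paths_assoc)
         (use wv lin ss that path_walk pr in auto)
    also have "\<dots> \<simeq> approach v (pathfinish p)"
      unfolding approach_def
      by (rule hom_join_cong) (use wv star_cone[OF that] path_walk in auto)
    finally show ?thesis .
  qed
  have transport: "approach v (g 0) +++ g \<simeq> approach w (g 1)"
    if g: "path g" "path_image g \<subseteq> realization" and v: "g 0 \<in> star v" and w: "g 1 \<in> star w" for g v w
  proof -
    obtain N :: nat where N: "N > 0"
      "\<And>i. i < N \<Longrightarrow> \<exists>v. g ` {real i / real N..real (Suc i) / real N} \<subseteq> star v"
      using path_star_subdivision[OF g] by blast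
    have "\<forall>u. g (real i / real N) \<in> star u \<longrightarrow>
           approach v (g 0) +++ subpath 0 (real i / real N) g \<simeq> approach u (g (real i / real N))"
      if "i \<le> N" for i
      using that
    proof (induction i)
      case 0
      show ?case
      proof (intro allI impI)
        fix u assume u: "g (real 0 / real N) \<in> star u"
        have "approach v (g 0) +++ linepath (g 0) (g 0) \<simeq> approach v (g 0)"
          using app[OF v] by (intro homotopic_paths_rid') auto
        also have "\<dots> \<simeq> approach u (g 0)" using indep v u by simp
        finally show "approach v (g 0) +++ subpath 0 (real 0 / real N) g \<simeq> approach u (g (real 0 / real N))"
          by (simp add: subpath_refl linepath_refl subpath_trivial)
      qed
    next
      case (Suc i)
      let ?s = "real i / real N" and ?t = "real (Suc i) / real N"
      have st: "?s \<in> {0..1}" "?t \<in> {0..1}" "?s \<le> ?t"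
        using Suc.prems N(1) by (auto simp: field_simps)
      obtain c where c: "g ` {?s..?t} \<subseteq> star c" using N(2)[of i] Suc.prems by auto
      have im: "path_image (subpath ?s ?t g) \<subseteq> star c"
        using c st(3) by (simp add: path_image_subpath)
      have pth: "path (subpath ?s ?t g)" using g st by (intro path_subpath)
      have gs: "g ?s \<in> star c" and gt: "g ?t \<in> star c" using c st(3) by auto
      have IH: "approach v (g 0) +++ subpath 0 ?s g \<simeq> approach c (g ?s)"
        using Suc gs by simp
      have sub: "path_image (subpath a b g) \<subseteq> realization" if "a \<in> {0..1}" "b \<in> {0..1}" for a b
        using path_image_subpath_subset[OF that, of g] g(2) by blast
      have "approach v (g 0) +++ subpath 0 ?t g \<simeq> approach v (g 0) +++ (subpath 0 ?s g +++ subpath ?s ?t g)"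
        by (rule hom_join_cong)
           (use app[OF v] st homotopic_join_subpaths[OF g, of 0 ?s ?t] in \<open>auto intro: homotopic_paths_sym\<close>)
      also have "\<dots> \<simeq> (approach v (g 0) +++ subpath 0 ?s g) +++ subpath ?s ?t g"
        by (rule homotopic_paths_assoc) (use app[OF v] st sub g in auto)
      also have "\<dots> \<simeq> approach c (g ?s) +++ subpath ?s ?t g"
        by (rule hom_join_cong) (use IH pth sub st in auto)
      also have "\<dots> \<simeq> approach c (g ?t)"
        using step[OF pth im] by simp
      finally have "approach v (g 0) +++ subpath 0 ?t g \<simeq> approach c (g ?t)" .
      then show ?case using indep gt homotopic_paths_trans by blast
    qed
    from this[of N] w N(1) show ?thesis by simp
  qed
  have somestar: "\<exists>v. x \<in> star v" if "x \<in> realization" for x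
  proof -
    from that obtain \<sigma> where s: "\<sigma> \<in> K" "x \<in> closed_simplex \<sigma>" by (auto simp: realization_def)
    from support_simplex(1)[OF s(2,1)] face_nonempty obtain v where "apply_bcontfun x v \<noteq> 0"
      by blast
    then show ?thesis using s that by (auto simp: star_def closed_simplex_def order_less_le)
  qed
  show ?thesis
    unfolding simply_connected_eq_contractible_path
  proof (intro conjI allI impI)
    show "path_connected realization"
      unfolding path_connected_def
    proof (intro ballI)
      fix x y assume xy: "x \<in> realization" "y \<in> realization"
      then obtain u v where "x \<in> star u" "y \<in> star v" using somestar by blast
      then show "\<exists>g. path g \<and> path_image g \<subseteq> realization \<and> pathstart g = x \<and> pathfinish g = y"
        using app by (intro exI[of _ "reversepath (approach u x) +++ approach v y"])
          (simp add: path_image_join)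
    qed
  next
    fix p assume p: "path p \<and> path_image p \<subseteq> realization \<and> pathfinish p = pathstart p"
    then have "pathstart p \<in> realization" by auto
    then obtain v where v: "pathstart p \<in> star v" using somestar by blast
    define q where "q = approach v (pathstart p)"
    note q = app[OF v, folded q_def]
    have t: "q +++ p \<simeq> q"
      using transport[of p v v] p v by (auto simp: q_def pathstart_def pathfinish_def)
    have "p \<simeq> linepath (pathstart p) (pathstart p) +++ p"
      using p by (intro homotopic_paths_sym[OF homotopic_paths_lid']) auto
    also have "\<dots> \<simeq> (reversepath q +++ q) +++ p"
      using homotopic_paths_linv[OF q(1,2)] q p
      by (intro hom_join_cong) (auto intro: homotopic_paths_sym)
    also have "\<dots> \<simeq> reversepath q +++ (q +++ p)"
      by (rule homotopic_paths_sym, rule homotopic_paths_assoc) (use q p in auto)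
    also have "\<dots> \<simeq> reversepath q +++ q"
      by (rule hom_join_cong) (use q t in auto)
    also have "\<dots> \<simeq> linepath (pathstart p) (pathstart p)"
      using homotopic_paths_linv[OF q(1,2)] q by simp
    finally show "p \<simeq> linepath (pathstart p) (pathstart p)" .
  qed
qed

text \<open>With finitely many vertices, coordinates and bounded coordinate functions determine each other continuously,
so loops and homotopies transfer between the two versions of the realization.\<close>

lemma geometric_realization_simply_connected:
  assumes T: "\<And>v. {v} \<in> K \<Longrightarrow> edge_path K (T v) \<and> hd (T v) = r \<and> last (T v) = v"
    and cone: "\<And>u v. {u, v} \<in> K \<Longrightarrow> edge_homotopic K (T u @ [v]) (T v)"
  shows "simply_connected_complex K"
proof -
  let ?R = "geometric_realization K"
  define lift :: "('a \<Rightarrow> real) \<Rightarrow> ('a \<Rightarrow>\<^sub>C real)"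
    where "lift x = (\<Sum>v\<in>\<Union>K. x v *\<^sub>R vertex v)" for x
  have apply_lift: "apply_bcontfun (lift x) = x" if "x \<in> ?R" for x
  proof
    fix u
    have lin: "apply_bcontfun (\<Sum>v\<in>A. f v) u = (\<Sum>v\<in>A. apply_bcontfun (f v) u)" for f :: "'a \<Rightarrow> ('a \<Rightarrow>\<^sub>C real)" and A
      by (induction A rule: infinite_finite_induct) (auto simp: plus_bcontfun.rep_eq)
    have "apply_bcontfun (lift x) u = (\<Sum>v\<in>\<Union>K. if u = v then x v else 0)"
      unfolding lift_def lin by (intro sum.cong) (auto simp: scaleR_bcontfun.rep_eq apply_vertex)
    also have "\<dots> = (if u \<in> \<Union>K then x u else 0)"
      using finite_vertices by (simp add: sum.delta)
    also have "\<dots> = x u" using that by (auto simp: geometric_realization_def)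
    finally show "apply_bcontfun (lift x) u = x u" .
  qed
  have cont_lift: "continuous_on ?R lift"
    unfolding lift_def
    by (intro continuous_intros continuous_on_product_then_coordinatewise continuous_on_id)
  have cont_apply: "continuous_on realization apply_bcontfun"
    by (intro continuous_on_coordinatewise_then_product continuous_apply_bcontfun)
  have sc: "simply_connected realization" by (rule realization_simply_connected[OF T cone])
  show ?thesis
    unfolding simply_connected_complex_def simply_connected_def
  proof (intro allI impI, elim conjE)
    fix p q assume p: "path p" "pathfinish p = pathstart p" "path_image p \<subseteq> ?R"
      and q: "path q" "pathfinish q = pathstart q" "path_image q \<subseteq> ?R"
    have lift_in: "lift x \<in> realization" if "x \<in> ?R" for x
      using that apply_lift realization_iff by metis
    have "path (lift \<circ> s)" "pathfinish (lift \<circ> s) = pathstart (lift \<circ> s)" "path_image (lift \<circ> s) \<subseteq> realization"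
      if "path s" "pathfinish s = pathstart s" "path_image s \<subseteq> ?R" for s
      using that lift_in continuous_on_subset[OF cont_lift]
      by (auto simp: path_continuous_image pathstart_compose pathfinish_compose path_image_compose)
    then have "homotopic_loops realization (lift \<circ> p) (lift \<circ> q)"
      using sc p q by (auto simp: simply_connected_def)
    then have "homotopic_loops ?R (apply_bcontfun \<circ> (lift \<circ> p)) (apply_bcontfun \<circ> (lift \<circ> q))"
      by (rule homotopic_loops_continuous_image[OF _ cont_apply]) (auto simp: realization_iff)
    moreover have "homotopic_loops ?R s (apply_bcontfun \<circ> (lift \<circ> s))"
      if "path s" "pathfinish s = pathstart s" "path_image s \<subseteq> ?R" for s
      using that by (intro homotopic_loops_eq) (auto simp: apply_lift path_image_def image_subset_iff)
    ultimately show "homotopic_loops ?R p q"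
      using p q by (meson homotopic_loops_sym homotopic_loops_trans)
  qed
qed

end

section \<open>Squares and pentagons in the clique complex\<close>

definition adj :: "'a set set \<Rightarrow> 'a \<Rightarrow> 'a \<Rightarrow> bool" where
  "adj E u v \<longleftrightarrow> u \<noteq> v \<and> {u, v} \<in> E"

definition common_nbrs :: "'a set set \<Rightarrow> 'a \<Rightarrow> 'a \<Rightarrow> 'a set" where
  "common_nbrs E u v = {x. adj E x u \<and> adj E x v}"

text \<open>At least one inner vertex is required so that the event depends only on edges that meet \<open>U\<close>.\<close>

definition joined_through :: "'a set set \<Rightarrow> 'a set \<Rightarrow> 'a \<Rightarrow> 'a \<Rightarrow> bool" where
  "joined_through E U a c \<longleftrightarrow> (\<exists>xs. xs \<noteq> [] \<and> set xs \<subseteq> U \<and> successively (adj E) (a # xs @ [c]))"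

text \<open>The edges of the square \<open>a b c d\<close> do not occur: the property can be demanded of all quadruples
of vertices, whether or not they span a square, and it is increasing in \<open>E\<close>.\<close>

definition fills_square :: "'a set set \<Rightarrow> 'a \<Rightarrow> 'a \<Rightarrow> 'a \<Rightarrow> 'a \<Rightarrow> bool" where
  "fills_square E a b c d \<longleftrightarrow>
     (\<exists>w \<in> common_nbrs E a c. joined_through E (common_nbrs E b w) a c \<and>
                              joined_through E (common_nbrs E d w) a c)"

text \<open>For an edge \<open>u v\<close>, two such vertices cut the closed paths
\<open>r, \<dots>, u, v, \<dots>, r\<close> of length five into a triangle \<open>r w w'\<close> and
squares. Excluding \<open>v\<close> and \<open>u\<close> as values of \<open>w\<close> and \<open>w'\<close>
keeps the square \<open>w u v w'\<close> from degenerating.\<close>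

definition splits_pentagon :: "'a set set \<Rightarrow> 'a \<Rightarrow> 'a \<Rightarrow> 'a \<Rightarrow> bool" where
  "splits_pentagon E r u v \<longleftrightarrow>
     (\<exists>w \<in> common_nbrs E r u - {v}. \<exists>w' \<in> common_nbrs E r v - {u}. adj E w w')"

lemma adj_commute: "adj E u v \<longleftrightarrow> adj E v u"
  by (auto simp: adj_def insert_commute)

lemma finite_complex_clique_complex:
  fixes V :: "'a::discrete_topology set"
  assumes "finite V"
  shows "finite_complex (clique_complex_2 V E)"
proof
  fix \<sigma> \<tau> assume s: "\<sigma> \<in> clique_complex_2 V E" "\<tau> \<subseteq> \<sigma>" "\<tau> \<noteq> {}"
  moreover from s have "card \<tau> \<le> card \<sigma>" by (intro card_mono) (auto simp: clique_complex_2_def)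
  ultimately show "\<tau> \<in> clique_complex_2 V E"
    by (auto simp: clique_complex_2_def finite_subset subset_iff)
next
  show "finite (\<Union>(clique_complex_2 V E))"
    by (rule finite_subset[OF _ assms]) (auto simp: clique_complex_2_def)
qed (auto simp: clique_complex_2_def)

locale clique_complex =
  fixes V :: "'a set" and E :: "'a set set"
  assumes edges: "\<And>u v. adj E u v \<Longrightarrow> u \<in> V \<and> v \<in> V"
begin

abbreviation "K \<equiv> clique_complex_2 V E"
abbreviation eqv (infix "\<sim>" 50) where "xs \<sim> ys \<equiv> edge_homotopic K xs ys"

lemma triangle_face:
  assumes "adj E u v" "adj E v w" "adj E u w"
  shows "{u, v, w} \<in> K"
  using assms edges[OF assms(1)] edges[OF assms(2)]
  by (auto simp: clique_complex_2_def adj_def insert_commute card_insert_if)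

lemma edge_face: "{u, v} \<in> K \<longleftrightarrow> (u = v \<and> u \<in> V) \<or> adj E u v"
  using edges[of u v]
  by (auto simp: clique_complex_2_def adj_def insert_commute card_insert_if)

lemma singleton_face: "{v} \<in> K \<longleftrightarrow> v \<in> V"
  using edge_face[of v v] by (auto simp: adj_def)

lemma in_context: "xs \<sim> ys \<Longrightarrow> us @ xs @ vs \<sim> us @ ys @ vs"
  by (rule edge_homotopic_context)

lemma collapse:
  assumes "adj E u v" "adj E v w" "adj E u w"
  shows "[u, v, w] \<sim> [u, w]"
  using edge_homotopic_triangle[OF triangle_face[OF assms], of "[]" "[]"] by simp

lemma backtrack:
  assumes "adj E u v"
  shows "[u, v, u] \<sim> [u]"
proof -
  have "{u, v, u} \<in> K" "{u} \<in> K"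
    using assms edge_face[of u v] edges[OF assms] by (auto simp: singleton_face insert_commute)
  then have "[u, v, u] \<sim> [u, u]" "[u, u] \<sim> [u]"
    using edge_homotopic_triangle[of u v u K "[]" "[]"] edge_homotopic_stutter[of u K "[]" "[]"] by auto
  then show ?thesis by (rule edge_homotopic_trans)
qed

lemmas eqv_trans [trans] = edge_homotopic_trans[of K]
lemmas eqv_sym = edge_homotopic_sym[of K]

text \<open>Each edge \<open>x y\<close> of the path spans with \<open>b\<close> and with \<open>w\<close> a triangle,
and the two triangles carry \<open>b, x, w\<close> to \<open>b, y, w\<close>.\<close>

lemma slide_along_path:
  assumes "successively (adj E) (a # xs @ [c])" "set xs \<subseteq> common_nbrs E b w"
    and "a \<in> common_nbrs E b w" "c \<in> common_nbrs E b w"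
  shows "[b, a, w] \<sim> [b, c, w]"
  using assms
proof (induction xs arbitrary: a)
  have step: "[b, a, w] \<sim> [b, x, w]"
    if "adj E a x" "a \<in> common_nbrs E b w" "x \<in> common_nbrs E b w" for a x
  proof -
    have *: "adj E a w" "adj E b a" "adj E b x" "adj E x w"
      using that by (auto simp: common_nbrs_def adj_commute)
    have "[b, a, w] \<sim> [b, a, x, w]"
      using in_context[OF collapse[of a x w], of "[b]" "[]"] * that(1) by - (rule eqv_sym, simp)
    also have "[b, a, x, w] \<sim> [b, x, w]"
      using in_context[OF collapse[of b a x], of "[]" "[w]"] * that(1) by simp
    finally show ?thesis .
  qed
  {
    case Nil
    then show ?case using step[of a c] by simp
  next
    case (Cons x xs)
    then have "[b, a, w] \<sim> [b, x, w]" using step[of a x] by simp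
    also have "[b, x, w] \<sim> [b, c, w]" using Cons by auto
    finally show ?case .
  }
qed

text \<open>Sliding turns \<open>a, b, c\<close> into \<open>a, w, c\<close>, and in the same way
\<open>a, d, c\<close> into \<open>a, w, c\<close>.\<close>

lemma square_contractible:
  assumes "adj E a b" "adj E b c" "adj E c d" "adj E d a" and "fills_square E a b c d"
  shows "[a, b, c] \<sim> [a, d, c]"
proof -
  obtain w where w: "w \<in> common_nbrs E a c" and
    j: "joined_through E (common_nbrs E b w) a c" "joined_through E (common_nbrs E d w) a c"
    using assms(5) by (auto simp: fills_square_def)
  have reroute: "[a, x, c] \<sim> [a, w, c]"
    if x: "adj E a x" "adj E x c" and j: "joined_through E (common_nbrs E x w) a c" for x
  proof -
    obtain xs where xs: "set xs \<subseteq> common_nbrs E x w" "successively (adj E) (a # xs @ [c])"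
      using j by (auto simp: joined_through_def)
    have slide: "[x, a, w] \<sim> [x, c, w]"
      using slide_along_path[OF xs(2,1)] x w by (auto simp: common_nbrs_def adj_commute)
    have wc: "adj E c w" using w by (auto simp: common_nbrs_def adj_commute)
    have "[a, x, c] \<sim> [a, x, c, w, c]"
      using in_context[OF backtrack[OF wc], of "[a, x]" "[]"] by - (rule eqv_sym, simp)
    also have "\<dots> \<sim> [a, x, a, w, c]"
      using in_context[OF slide, of "[a]" "[c]"] by - (rule eqv_sym, simp)
    also have "\<dots> \<sim> [a, w, c]"
      using in_context[OF backtrack[OF x(1)], of "[]" "[w, c]"] by simp
    finally show ?thesis .
  qed
  have "[a, b, c] \<sim> [a, w, c]" using reroute j(1) assms by blast
  also have "\<dots> \<sim> [a, d, c]"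
    using reroute[of d] j(2) assms by - (rule eqv_sym, auto simp: adj_commute)
  finally show ?thesis .
qed

end

text \<open>Let \<open>T v\<close> run from a root \<open>r\<close> to \<open>v\<close> through any common neighbour;
squares make the choice immaterial. For an edge \<open>u v\<close>, the paths \<open>T u\<close> followed by
\<open>v\<close> and \<open>T v\<close> bound a pentagon, which is cut into squares and a triangle; if
\<open>r\<close> is \<open>u\<close> or \<open>v\<close>, the closed path collapses over a triangle.\<close>

theorem clique_complex_simply_connected:
  fixes V :: "'a::discrete_topology set"
  assumes "finite V" "card V \<ge> 3" and edges: "\<And>u v. adj E u v \<Longrightarrow> u \<in> V \<and> v \<in> V"
    and squares: "\<And>a b c d. {a, b, c, d} \<subseteq> V \<Longrightarrow> distinct [a, b, c, d] \<Longrightarrow> fills_square E a b c d"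
    and pentagons: "\<And>r u v. {r, u, v} \<subseteq> V \<Longrightarrow> distinct [r, u, v] \<Longrightarrow> splits_pentagon E r u v"
  shows "simply_connected_complex (clique_complex_2 V E)"
proof -
  interpret clique_complex V E using edges by unfold_locales
  obtain r where r: "r \<in> V" using assms(2) by fastforce
  have "\<exists>m. adj E r m \<and> adj E m v" if v: "v \<in> V" "v \<noteq> r" for v
  proof -
    have "card (V - {r, v}) > 0"
      using assms(1,2) v r by (simp add: card_Diff_subset)
    then obtain u where "u \<in> V" "u \<noteq> r" "u \<noteq> v" by (metis card_gt_0_iff ex_in_conv Diff_iff insertCI)
    then have "splits_pentagon E r v u" using pentagons v r by auto
    then show ?thesis by (auto simp: splits_pentagon_def common_nbrs_def adj_commute)
  qed
  then obtain m where m: "\<And>v. v \<in> V \<Longrightarrow> v \<noteq> r \<Longrightarrow> adj E r (m v) \<and> adj E (m v) v"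
    by metis
  define T where "T v = (if v = r then [r] else [r, m v, v])" for v
  have flip: "[a, b, c] \<sim> [a, d, c]"
    if "adj E a b" "adj E b c" "adj E c d" "adj E d a" "a \<noteq> c" for a b c d
  proof (cases "b = d")
    case False
    then have "fills_square E a b c d"
      using that edges by (intro squares) (auto simp: adj_def)
    then show ?thesis using square_contractible that by blast
  qed (auto intro: edge_homotopic_refl)
  have cone: "T u @ [v] \<sim> T v" if uv: "adj E u v" for u v
  proof -
    have V: "u \<in> V" "v \<in> V" "u \<noteq> v" using edges[OF uv] uv by (auto simp: adj_def)
    consider "u = r" | "v = r" | "u \<noteq> r" "v \<noteq> r" by blast
    then show ?thesis
    proof cases
      case 1
      then show ?thesis
        using m[of v] V uv eqv_sym[OF collapse[of r "m v" v]] by (auto simp: T_def)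
    next
      case 2
      then have *: "adj E r (m u)" "adj E (m u) u" "u \<noteq> r" using m[of u] V by auto
      have "[r, m u, u, r] \<sim> [r, m u, r]"
        using in_context[OF collapse[of "m u" u r], of "[r]" "[]"] * uv 2 by (simp add: adj_commute)
      also have "\<dots> \<sim> [r]" using backtrack * by blast
      finally show ?thesis using 2 * by (simp add: T_def)
    next
      case 3
      obtain w w' where w: "adj E w r" "adj E w u" "w \<noteq> v"
        and w': "adj E w' r" "adj E w' v" "w' \<noteq> u" and ww: "adj E w w'"
        using pentagons[of r u v] V r 3 by (auto simp: splits_pentagon_def common_nbrs_def)
      have mu: "adj E r (m u)" "adj E (m u) u" and mv: "adj E r (m v)" "adj E (m v) v"
        using m V 3 by auto
      have "[r, m u, u, v] \<sim> [r, w, u, v]"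
        using in_context[OF flip[of r "m u" u w], of "[]" "[v]"] mu w 3 by (simp add: adj_commute)
      also have "\<dots> \<sim> [r, w, w', v]"
        using in_context[OF flip[of w u v w'], of "[r]" "[]"] w w' uv ww by (simp add: adj_commute)
      also have "\<dots> \<sim> [r, w', v]"
        using in_context[OF collapse[of r w w'], of "[]" "[v]"] w w' ww by (simp add: adj_commute)
      also have "\<dots> \<sim> [r, m v, v]"
        using flip[of r w' v "m v"] mv w' 3 by (simp add: adj_commute)
      finally show ?thesis using 3 by (simp add: T_def)
    qed
  qed
  show ?thesis
  proof (rule finite_complex.geometric_realization_simply_connected[where T = T and r = r])
    show "finite_complex K" using finite_complex_clique_complex assms(1) .
  next
    fix v assume "{v} \<in> K"
    then show "edge_path K (T v) \<and> hd (T v) = r \<and> last (T v) = v"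
      using r m[of v] edges by (auto simp: T_def edge_path_def singleton_face edge_face)
  next
    fix u v assume "{u, v} \<in> K"
    then show "T u @ [v] \<sim> T v"
    proof (cases "u = v")
      case True
      then have "{u} \<in> K" using \<open>{u, v} \<in> K\<close> by simp
      then show ?thesis
        using True edge_homotopic_stutter[of u K "butlast (T u)" "[]"] by (simp add: T_def split: if_splits)
    qed (use cone edge_face in auto)
  qed
qed

section \<open>Independent coins\<close>

abbreviation coins :: "'e set \<Rightarrow> real \<Rightarrow> ('e \<Rightarrow> bool) pmf" where
  "coins I p \<equiv> Pi_pmf I False (\<lambda>_. bernoulli_pmf p)"

definition determined_by :: "'e set \<Rightarrow> (('e \<Rightarrow> bool) \<Rightarrow> 'b) \<Rightarrow> bool" where
  "determined_by A F \<longleftrightarrow> (\<forall>f g. (\<forall>e\<in>A. f e = g e) \<longrightarrow> F f = F g)"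

lemma determined_byD: "determined_by A F \<Longrightarrow> (\<And>e. e \<in> A \<Longrightarrow> f e = g e) \<Longrightarrow> F f = F g"
  by (auto simp: determined_by_def)

lemma determined_by_mono: "determined_by A F \<Longrightarrow> A \<subseteq> B \<Longrightarrow> determined_by B F"
  unfolding determined_by_def by blast

lemma determined_by_comp: "determined_by A F \<Longrightarrow> determined_by A (\<lambda>f. G (F f))"
  unfolding determined_by_def by metis

lemma finite_coins: "finite I \<Longrightarrow> finite (set_pmf (coins I p))"
  by (simp add: set_Pi_pmf finite_PiE_dflt)

lemma integrable_coins: "finite I \<Longrightarrow> integrable (coins I p) (F :: _ \<Rightarrow> real)"
  by (rule integrable_measure_pmf_finite[OF finite_coins])

lemma expectation_pair:
  fixes h :: "'a \<times> 'b \<Rightarrow> real"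
  assumes "finite (set_pmf P)" "finite (set_pmf Q)"
  shows "measure_pmf.expectation (pair_pmf P Q) h =
         measure_pmf.expectation P (\<lambda>x. measure_pmf.expectation Q (\<lambda>y. h (x, y)))"
proof -
  have "measure_pmf.expectation (pair_pmf P Q) h =
        (\<Sum>z\<in>set_pmf P \<times> set_pmf Q. pmf (pair_pmf P Q) z *\<^sub>R h z)"
    using assms by (intro integral_measure_pmf) auto
  also have "\<dots> = (\<Sum>x\<in>set_pmf P. pmf P x *\<^sub>R (\<Sum>y\<in>set_pmf Q. pmf Q y *\<^sub>R h (x, y)))"
    by (simp add: sum.cartesian_product' pmf_pair sum_distrib_left mult.assoc)
  also have "\<dots> = measure_pmf.expectation P (\<lambda>x. \<Sum>y\<in>set_pmf Q. pmf Q y *\<^sub>R h (x, y))"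
    using assms by (intro integral_measure_pmf[symmetric]) auto
  also have "\<dots> = measure_pmf.expectation P (\<lambda>x. measure_pmf.expectation Q (\<lambda>y. h (x, y)))"
    using assms by (intro arg_cong[of _ _ "measure_pmf.expectation P"] ext integral_measure_pmf[symmetric]) auto
  finally show ?thesis .
qed

lemma expectation_cong:
  "(\<And>x. x \<in> set_pmf P \<Longrightarrow> F x = G x) \<Longrightarrow> measure_pmf.expectation P F = measure_pmf.expectation P (G :: _ \<Rightarrow> real)"
  by (intro integral_cong_AE) (auto simp: AE_measure_pmf_iff)

text \<open>The coins in \<open>A\<close> and the others are independent, so the others may be drawn afresh once those in
\<open>A\<close> have been seen.\<close>

lemma expectation_two_stage:
  fixes h :: "('e \<Rightarrow> bool) \<Rightarrow> ('e \<Rightarrow> bool) \<Rightarrow> real"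
  assumes I: "finite I"
    and A: "\<And>g. determined_by A (\<lambda>f. h f g)" and B: "\<And>f. determined_by (-A) (h f)"
  shows "measure_pmf.expectation (coins I p) (\<lambda>f. h f f) =
         measure_pmf.expectation (coins I p) (\<lambda>f. measure_pmf.expectation (coins I p) (h f))"
proof -
  let ?P = "coins (I \<inter> A) p" and ?Q = "coins (I - A) p"
  let ?m = "\<lambda>f g x. if x \<in> I \<inter> A then f x else g x"
  let ?m' = "\<lambda>f g x. if x \<in> A then f x else g x"
  have split: "coins I p = map_pmf (\<lambda>(f, g). ?m f g) (pair_pmf ?P ?Q)"
  proof -
    have "I = (I \<inter> A) \<union> (I - A)" by blast
    then have "coins I p = coins ((I \<inter> A) \<union> (I - A)) p" by simp
    then show ?thesis using I by (subst (asm) Pi_pmf_union) auto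
  qed
  have fin: "finite (set_pmf ?P)" "finite (set_pmf ?Q)" using I by (auto intro: finite_coins)
  have ex: "measure_pmf.expectation (coins I p) F =
      measure_pmf.expectation ?P (\<lambda>f. measure_pmf.expectation ?Q (\<lambda>g. F (?m f g)))" for F :: "_ \<Rightarrow> real"
    unfolding split using expectation_pair[OF fin, of "\<lambda>(f, g). F (?m f g)"]
    by (simp add: case_prod_unfold)
  have outside: "f x = False" if "f \<in> set_pmf (coins J p)" "x \<notin> J" "finite J" for f x and J :: "'e set"
    using set_Pi_pmf_subset[OF that(3), of False "\<lambda>_. bernoulli_pmf p"] that by blast
  have eq: "h (?m f g) (?m f' g') = h f g'"
    if "f \<in> set_pmf ?P" "f' \<in> set_pmf ?P" "g \<in> set_pmf ?Q" "g' \<in> set_pmf ?Q" for f g f' g'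
  proof -
    have "h (?m f g) (?m f' g') = h f (?m f' g')"
      by (rule determined_byD[OF A]) (use outside[of f "I \<inter> A"] outside[of g "I - A"] that I in auto)
    also have "\<dots> = h f g'"
      by (rule determined_byD[OF B]) auto
    finally show ?thesis .
  qed
  have "measure_pmf.expectation (coins I p) (\<lambda>f. h f f) =
      measure_pmf.expectation ?P (\<lambda>f. measure_pmf.expectation ?Q (\<lambda>g. h f g))"
    unfolding ex by (intro expectation_cong eq)
  moreover have "measure_pmf.expectation (coins I p) (\<lambda>f. measure_pmf.expectation (coins I p) (h f)) =
      measure_pmf.expectation ?P (\<lambda>f. measure_pmf.expectation ?Q (\<lambda>g.
        measure_pmf.expectation ?P (\<lambda>f'. measure_pmf.expectation ?Q (\<lambda>g'. h f g'))))"
    unfolding ex by (intro expectation_cong eq)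
  ultimately show ?thesis by simp
qed

abbreviation prob :: "'a pmf \<Rightarrow> ('a \<Rightarrow> bool) \<Rightarrow> real" where
  "prob P A \<equiv> measure_pmf.prob P {x. A x}"

lemma expectation_of_bool: "measure_pmf.expectation P (\<lambda>x. of_bool (A x)) = prob P A"
proof -
  have "measure_pmf.expectation P (\<lambda>x. of_bool (A x)) = measure_pmf.expectation P (indicator {x. A x})"
    by (intro arg_cong[of _ _ "measure_pmf.expectation P"]) (auto simp: fun_eq_iff)
  also have "\<dots> = prob P A" by simp
  finally show ?thesis .
qed

text \<open>The form in which conditioning is used below: a bound for the second stage that holds for every outcome of the
first stage holds for both stages together.\<close>

lemma prob_two_stage_le:
  assumes I: "finite I"
    and A: "\<And>g. determined_by A (\<lambda>f. Q f g)" and B: "\<And>f. determined_by (-A) (Q f)"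
    and le: "\<And>f. prob (coins I p) (Q f) \<le> \<delta>"
  shows "prob (coins I p) (\<lambda>f. Q f f) \<le> \<delta>"
proof -
  have "prob (coins I p) (\<lambda>f. Q f f) = measure_pmf.expectation (coins I p) (\<lambda>f. of_bool (Q f f))"
    by (simp add: expectation_of_bool)
  also have "\<dots> = measure_pmf.expectation (coins I p) (\<lambda>f. measure_pmf.expectation (coins I p) (\<lambda>g. of_bool (Q f g)))"
    by (rule expectation_two_stage[OF I, of A]; rule determined_by_comp[where G = of_bool]; rule A B)
  also have "\<dots> = measure_pmf.expectation (coins I p) (\<lambda>f. prob (coins I p) (Q f))"
    by (simp add: expectation_of_bool)
  also have "\<dots> \<le> measure_pmf.expectation (coins I p) (\<lambda>f. \<delta>)"
    by (intro integral_mono integrable_coins I le)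
  finally show ?thesis by simp
qed

lemma expectation_prod_disjoint:
  fixes X :: "'j \<Rightarrow> ('e \<Rightarrow> bool) \<Rightarrow> real"
  assumes I: "finite I" and J: "finite J"
    and det: "\<And>j. j \<in> J \<Longrightarrow> determined_by (B j) (X j)"
    and disj: "disjoint_family_on B J"
  shows "measure_pmf.expectation (coins I p) (\<lambda>f. \<Prod>j\<in>J. X j f) =
         (\<Prod>j\<in>J. measure_pmf.expectation (coins I p) (X j))"
  using J det disj
proof (induction J rule: finite_induct)
  case (insert k J)
  have dis: "B j \<inter> B k = {}" if "j \<in> J" for j
    using insert.prems(2) insert.hyps(2) that by (auto simp: disjoint_family_on_def)
  have "measure_pmf.expectation (coins I p) (\<lambda>f. \<Prod>j\<in>insert k J. X j f) =
        measure_pmf.expectation (coins I p) (\<lambda>f. X k f * (\<Prod>j\<in>J. X j f))"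
    using insert.hyps by simp
  also have "\<dots> = measure_pmf.expectation (coins I p)
          (\<lambda>f. measure_pmf.expectation (coins I p) (\<lambda>g. X k f * (\<Prod>j\<in>J. X j g)))"
  proof (rule expectation_two_stage[OF I, of "B k"])
    fix g show "determined_by (B k) (\<lambda>f. X k f * (\<Prod>j\<in>J. X j g))"
      using insert.prems(1)[of k] by (auto simp: determined_by_def)
  next
    fix f show "determined_by (- B k) (\<lambda>g. X k f * (\<Prod>j\<in>J. X j g))"
      unfolding determined_by_def
    proof (intro allI impI)
      fix g g' :: "'e \<Rightarrow> bool" assume g: "\<forall>e\<in>- B k. g e = g' e"
      have "X j g = X j g'" if "j \<in> J" for j
        by (rule determined_byD[OF insert.prems(1)]) (use that g dis in auto)
      then show "X k f * (\<Prod>j\<in>J. X j g) = X k f * (\<Prod>j\<in>J. X j g')" by simp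
    qed
  qed
  also have "\<dots> = measure_pmf.expectation (coins I p) (X k) * measure_pmf.expectation (coins I p) (\<lambda>g. \<Prod>j\<in>J. X j g)"
    by simp
  also have "measure_pmf.expectation (coins I p) (\<lambda>g. \<Prod>j\<in>J. X j g) = (\<Prod>j\<in>J. measure_pmf.expectation (coins I p) (X j))"
    using insert by (intro insert.IH) (auto simp: disjoint_family_on_def)
  finally show ?case using insert.hyps by simp
qed simp

lemma prob_all_disjoint:
  assumes I: "finite I" and J: "finite J"
    and det: "\<And>j. j \<in> J \<Longrightarrow> determined_by (B j) (A j)"
    and disj: "disjoint_family_on B J"
  shows "prob (coins I p) (\<lambda>f. \<forall>j\<in>J. A j f) = (\<Prod>j\<in>J. prob (coins I p) (A j))"
proof -
  have "prob (coins I p) (\<lambda>f. \<forall>j\<in>J. A j f) = measure_pmf.expectation (coins I p) (\<lambda>f. \<Prod>j\<in>J. of_bool (A j f))"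
    unfolding expectation_of_bool[symmetric] using J by (intro integral_cong_AE) (auto simp: prod_zero_iff)
  also have "\<dots> = (\<Prod>j\<in>J. measure_pmf.expectation (coins I p) (\<lambda>f. of_bool (A j f)))"
    by (rule expectation_prod_disjoint[OF I J _ disj]) (rule determined_by_comp[where G = of_bool], rule det)
  finally show ?thesis by (simp add: expectation_of_bool)
qed

lemma prob_Not: "prob P (\<lambda>x. \<not> A x) = 1 - prob P A"
  using measure_pmf.prob_compl[of "{x. A x}" P] by (simp add: Collect_neg_eq Compl_eq_Diff_UNIV)

lemma exp_minus_le_quadratic:
  fixes x :: real assumes "0 \<le> x"
  shows "exp (- x) \<le> 1 - x + x\<^sup>2 / 2"
proof -
  have "1 \<le> (1 - x + x\<^sup>2 / 2) * (1 + x + x\<^sup>2 / 2)"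
    using assms by (simp add: field_simps power2_eq_square)
  also have "\<dots> \<le> (1 - x + x\<^sup>2 / 2) * exp x"
  proof (rule mult_left_mono)
    show "1 + x + x\<^sup>2 / 2 \<le> exp x" using exp_lower_Taylor_quadratic[OF assms] by simp
    have "0 \<le> (1 - x)\<^sup>2 + 1" by simp
    then show "0 \<le> 1 - x + x\<^sup>2 / 2" by (simp add: power2_eq_square field_simps)
  qed
  finally show ?thesis by (simp add: exp_minus field_simps)
qed

text \<open>Chernoff bound, by Markov's inequality for \<open>exp (- \<delta> * X)\<close> where \<open>X\<close>
counts the events that occur.\<close>

lemma lower_tail:
  assumes I: "finite I" and J: "finite J"
    and det: "\<And>j. j \<in> J \<Longrightarrow> determined_by (B j) (A j)"
    and disj: "disjoint_family_on B J"
    and s: "\<And>j. j \<in> J \<Longrightarrow> s \<le> prob (coins I p) (A j)"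
    and s0: "0 \<le> s" and \<delta>: "0 \<le> \<delta>"
  shows "prob (coins I p) (\<lambda>f. real (card {j\<in>J. A j f}) \<le> (1 - \<delta>) * s * real (card J))
           \<le> exp (- s * real (card J) * \<delta>\<^sup>2 / 2)"
proof -
  let ?E = "measure_pmf.expectation (coins I p)"
  define Y where "Y j f = exp (- \<delta> * of_bool (A j f))" for j f
  define M where "M = (1 - \<delta>) * s * real (card J)"
  have prodY: "(\<Prod>j\<in>J. Y j f) = exp (- \<delta> * real (card {j\<in>J. A j f}))" for f
  proof -
    have "(\<Prod>j\<in>J. Y j f) = exp (\<Sum>j\<in>J. - \<delta> * of_bool (A j f))"
      unfolding Y_def using J by (simp add: exp_sum)
    also have "(\<Sum>j\<in>J. - \<delta> * of_bool (A j f)) = - \<delta> * real (card {j\<in>J. A j f})"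
      using J by (simp add: sum_distrib_left[symmetric] sum_negf Int_def)
    finally show ?thesis .
  qed
  have EY: "?E (Y j) \<le> exp (- s * (\<delta> - \<delta>\<^sup>2 / 2))" if j: "j \<in> J" for j
  proof -
    have "?E (Y j) = ?E (\<lambda>f. 1 - (1 - exp (-\<delta>)) * of_bool (A j f))"
      by (intro integral_cong_AE) (auto simp: Y_def)
    also have "\<dots> = 1 - (1 - exp (-\<delta>)) * prob (coins I p) (A j)"
      by (subst Bochner_Integration.integral_diff) (auto simp: integrable_coins I expectation_of_bool)
    also have "\<dots> \<le> 1 - (1 - exp (-\<delta>)) * s"
      using s[OF j] \<delta> by (intro diff_left_mono mult_left_mono) auto
    also have "\<dots> \<le> exp (- ((1 - exp (-\<delta>)) * s))"
      using exp_ge_add_one_self[of "- ((1 - exp (-\<delta>)) * s)"] by simp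
    also have "\<dots> \<le> exp (- s * (\<delta> - \<delta>\<^sup>2 / 2))"
      using mult_left_mono[OF exp_minus_le_quadratic[OF \<delta>(1)] s0] by (simp add: algebra_simps)
    finally show ?thesis .
  qed
  have "prob (coins I p) (\<lambda>f. real (card {j\<in>J. A j f}) \<le> M) \<le> exp (\<delta> * M) * ?E (\<lambda>f. \<Prod>j\<in>J. Y j f)"
  proof -
    have "prob (coins I p) (\<lambda>f. real (card {j\<in>J. A j f}) \<le> M) =
        ?E (\<lambda>f. of_bool (real (card {j\<in>J. A j f}) \<le> M))" by (simp add: expectation_of_bool)
    also have "\<dots> \<le> ?E (\<lambda>f. exp (\<delta> * M) * (\<Prod>j\<in>J. Y j f))"
    proof (intro integral_mono integrable_coins I)
      fix f
      have "1 \<le> exp (\<delta> * (M - real (card {j\<in>J. A j f})))" if "real (card {j\<in>J. A j f}) \<le> M"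
        using that \<delta> by simp
      then show "of_bool (real (card {j\<in>J. A j f}) \<le> M) \<le> exp (\<delta> * M) * (\<Prod>j\<in>J. Y j f)"
        unfolding prodY exp_add[symmetric] by (auto simp: algebra_simps)
    qed
    finally show ?thesis by simp
  qed
  also have "?E (\<lambda>f. \<Prod>j\<in>J. Y j f) = (\<Prod>j\<in>J. ?E (Y j))"
    by (rule expectation_prod_disjoint[OF I J _ disj])
       (unfold Y_def, rule determined_by_comp[where G = "\<lambda>b. exp (- \<delta> * of_bool b)"], rule det)
  also have "\<dots> \<le> (\<Prod>j\<in>J. exp (- s * (\<delta> - \<delta>\<^sup>2 / 2)))"
    by (intro prod_mono conjI EY) (auto simp: Y_def)
  also have "\<dots> = exp (real (card J) * (- s * (\<delta> - \<delta>\<^sup>2 / 2)))"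
    by (simp only: prod_constant exp_of_nat_mult)
  also have "exp (\<delta> * M) * \<dots> = exp (- s * real (card J) * \<delta>\<^sup>2 / 2)"
    unfolding exp_add[symmetric] M_def by (simp add: algebra_simps power2_eq_square)
  finally show ?thesis by (simp add: M_def mult_left_mono)
qed

lemma prob_pattern:
  assumes I: "finite I" and F: "F \<subseteq> I" and G: "G \<subseteq> I" and "F \<inter> G = {}" and p: "0 \<le> p" "p \<le> 1"
  shows "prob (coins I p) (\<lambda>f. (\<forall>e\<in>F. f e) \<and> (\<forall>e\<in>G. \<not> f e)) = p ^ card F * (1 - p) ^ card G"
proof -
  let ?B = "\<lambda>e. if e \<in> F then {True} else if e \<in> G then {False} else UNIV"
  have "{f. (\<forall>e\<in>F. f e) \<and> (\<forall>e\<in>G. \<not> f e)} = Pi I ?B"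
    using F G \<open>F \<inter> G = {}\<close> by (auto simp: Pi_def split: if_splits)
  then have "prob (coins I p) (\<lambda>f. (\<forall>e\<in>F. f e) \<and> (\<forall>e\<in>G. \<not> f e)) =
      (\<Prod>e\<in>I. measure_pmf.prob (bernoulli_pmf p) (?B e))"
    using measure_Pi_pmf_Pi[OF I] by simp
  also have "\<dots> = (\<Prod>e\<in>F \<union> G. measure_pmf.prob (bernoulli_pmf p) (?B e))"
    by (rule prod.mono_neutral_right) (use I F G in auto)
  also have "\<dots> = (\<Prod>e\<in>F. measure_pmf.prob (bernoulli_pmf p) (?B e)) * (\<Prod>e\<in>G. measure_pmf.prob (bernoulli_pmf p) (?B e))"
    by (rule prod.union_disjoint) (use I F G \<open>F \<inter> G = {}\<close> finite_subset in auto)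
  also have "(\<Prod>e\<in>F. measure_pmf.prob (bernoulli_pmf p) (?B e)) = p ^ card F"
    using p by (simp add: measure_pmf_single)
  also have "(\<Prod>e\<in>G. measure_pmf.prob (bernoulli_pmf p) (?B e)) = (\<Prod>e\<in>G. 1 - p)"
    by (rule prod.cong) (use p \<open>F \<inter> G = {}\<close> in \<open>auto simp: measure_pmf_single\<close>)
  finally show ?thesis by simp
qed

text \<open>By induction on the coins: splitting off one coin writes the probability as
\<open>p * a + (1 - p) * b\<close>, where \<open>a\<close> and \<open>b\<close> are the probabilities
given that the coin shows true or false; here \<open>a \<ge> b\<close>, and both grow with \<open>p\<close>.\<close>

lemma prob_coins_mono:
  fixes U :: "('e \<Rightarrow> bool) \<Rightarrow> bool"
  assumes I: "finite I" and U: "\<And>f g. U f \<Longrightarrow> (\<And>e. f e \<Longrightarrow> g e) \<Longrightarrow> U g"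
    and pq: "0 \<le> p" "p \<le> q" "q \<le> 1"
  shows "prob (coins I p) U \<le> prob (coins I q) U"
  using I U
proof (induction I arbitrary: U rule: finite_induct)
  case (insert x I)
  define a where "a r b = prob (coins I r) (\<lambda>f. U (f(x := b)))" for r b
  have step: "prob (coins (insert x I) r) U = r * a r True + (1 - r) * a r False"
    if "0 \<le> r" "r \<le> 1" for r
  proof -
    have "prob (coins (insert x I) r) U =
        measure_pmf.expectation (pair_pmf (bernoulli_pmf r) (coins I r)) (\<lambda>(y, f). of_bool (U (f(x := y))))"
      unfolding expectation_of_bool[symmetric] using insert.hyps
      by (simp add: Pi_pmf_insert case_prod_unfold)
    also have "\<dots> = r * a r True + (1 - r) * a r False"
      using that finite_coins[OF insert.hyps(1)]
      by (simp add: expectation_pair expectation_of_bool a_def finite_subset[OF subset_UNIV])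
    finally show ?thesis .
  qed
  have mono: "a p b \<le> a q b" for b
    unfolding a_def by (rule insert.IH, erule insert.prems) (auto split: if_splits)
  have "a p False \<le> a p True"
    unfolding a_def by (intro measure_pmf.finite_measure_mono) (auto intro: insert.prems)
  then have "p * a p True + (1 - p) * a p False \<le> q * a p True + (1 - q) * a p False"
    using pq mult_right_mono[of p q "a p True - a p False"] by (simp add: algebra_simps)
  also have "\<dots> \<le> q * a q True + (1 - q) * a q False"
    using pq mono by (intro add_mono mult_left_mono) auto
  finally show ?case using step[of p] step[of q] pq by simp
qed simp

section \<open>Paths between two vertices of a sparse random graph\<close>

fun path_edges :: "'v list \<Rightarrow> 'v set set" where
  "path_edges (u # v # vs) = insert {u, v} (path_edges (v # vs))"
| "path_edges _ = {}"

lemma path_edges_Cons: "xs \<noteq> [] \<Longrightarrow> path_edges (v # xs) = insert {v, hd xs} (path_edges xs)"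
  by (cases xs) auto

lemma finite_path_edges [simp]: "finite (path_edges xs)"
  by (induction xs rule: path_edges.induct) auto

lemma path_edges_subset: "e \<in> path_edges xs \<Longrightarrow> e \<subseteq> set xs"
  by (induction xs rule: path_edges.induct) auto

lemma path_edgesE:
  assumes "e \<in> path_edges xs" "distinct xs"
  obtains u v where "e = {u, v}" "u \<noteq> v"
  using assms by (induction xs rule: path_edges.induct) auto

lemma new_edge: "v \<notin> set xs \<Longrightarrow> {v, u} \<notin> path_edges xs"
  using path_edges_subset by blast

lemma card_path_edges: "distinct xs \<Longrightarrow> card (path_edges xs) = length xs - 1"
  by (induction xs rule: path_edges.induct) (auto simp: new_edge)

lemma successively_adj_path_edges:
  "distinct xs \<Longrightarrow> path_edges xs \<subseteq> E \<Longrightarrow> successively (adj E) xs"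
  by (induction xs rule: path_edges.induct) (auto simp: adj_def)

lemma path_nbrs:
  assumes "distinct xs"
  shows "card {v. {v, x} \<in> path_edges xs} \<le> 2 \<and>
         (x = hd xs \<or> x = last xs \<longrightarrow> card {v. {v, x} \<in> path_edges xs} \<le> 1)"
  using assms
proof (induction xs rule: path_edges.induct)
  case (1 u v vs)
  let ?N = "\<lambda>xs x. {w. {w, x} \<in> path_edges xs}"
  have fin: "finite (?N xs x)" for xs x
    by (rule finite_subset[of _ "set xs"]) (use path_edges_subset in fastforce)+
  have new: "{u, w} \<notin> path_edges (v # vs)" "{w, u} \<notin> path_edges (v # vs)" for w
    using new_edge[of u "v # vs" w] 1(2) by (auto simp: insert_commute)
  consider "x = u" | "x = v" | "x \<noteq> u" "x \<noteq> v" by blast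
  then show ?case
  proof cases
    case 1
    have "?N (u # v # vs) x \<subseteq> {v}"
      using 1 new by (auto simp: doubleton_eq_iff)
    then have "card (?N (u # v # vs) x) \<le> 1" using card_mono[of "{v}"] by fastforce
    then show ?thesis by linarith
  next
    case 2
    have uv: "u \<noteq> v" using 1(2) by auto
    have sub: "?N (u # v # vs) x \<subseteq> insert u (?N (v # vs) x)"
      using 2 by (auto simp: doubleton_eq_iff)
    have "card (?N (u # v # vs) x) \<le> card (insert u (?N (v # vs) x))"
      by (rule card_mono[OF _ sub]) (simp add: fin)
    also have "\<dots> \<le> Suc (card (?N (v # vs) x))"
      by (simp add: card_insert_if fin)
    finally have le: "card (?N (u # v # vs) x) \<le> Suc (card (?N (v # vs) x))" .
    have IH: "card (?N (v # vs) x) \<le> 1" using 1 2 by simp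
    show ?thesis
    proof (cases "x = last (u # v # vs)")
      case True
      then have "vs = []" using 2 1(2) by (cases vs rule: rev_cases) auto
      then show ?thesis using le by simp
    next
      case False
      then show ?thesis using le IH uv 2 by simp
    qed
  next
    case 3
    then have "?N (u # v # vs) x = ?N (v # vs) x" by (auto simp: doubleton_eq_iff)
    then show ?thesis using 1 3 by auto
  qed
qed auto

text \<open>With \<open>X\<close> the number of events that occur and \<open>B\<close> the indicator of
\<open>X > 0\<close>, the expectation of \<open>(X - Z * B)\<^sup>2\<close> is nonnegative, and
\<open>X * B = X\<close>.\<close>

lemma second_moment:
  fixes A :: "'i \<Rightarrow> 'e \<Rightarrow> bool" and P :: "'e pmf"
  assumes fin: "finite (set_pmf P)" "finite L" and Z: "Z > 0"
    and le: "(\<Sum>i\<in>L. \<Sum>j\<in>L. prob P (\<lambda>x. A i x \<and> A j x)) \<le> Z * (\<Sum>i\<in>L. prob P (A i))"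
  shows "(\<Sum>i\<in>L. prob P (A i)) / Z \<le> prob P (\<lambda>x. \<exists>i\<in>L. A i x)"
proof -
  let ?E = "measure_pmf.expectation P"
  define X where "X x = (\<Sum>i\<in>L. of_bool (A i x) :: real)" for x
  define B where "B x = (of_bool (\<exists>i\<in>L. A i x) :: real)" for x
  have int: "integrable P F" for F :: "_ \<Rightarrow> real" by (rule integrable_measure_pmf_finite[OF fin(1)])
  have EX: "?E X = (\<Sum>i\<in>L. prob P (A i))"
    unfolding X_def by (simp add: Bochner_Integration.integral_sum int expectation_of_bool)
  have EB: "?E B = prob P (\<lambda>x. \<exists>i\<in>L. A i x)"
    unfolding B_def by (rule expectation_of_bool)
  have EX2: "?E (\<lambda>x. X x * X x) = (\<Sum>i\<in>L. \<Sum>j\<in>L. prob P (\<lambda>x. A i x \<and> A j x))"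
    unfolding X_def sum_product
    by (simp add: Bochner_Integration.integral_sum int expectation_of_bool flip: of_bool_conj)
  have "0 \<le> X x * X x - 2 * Z * X x + Z * Z * B x" for x
  proof -
    have "X x * B x = X x"
    proof (cases "\<exists>i\<in>L. A i x")
      case True
      then have "B x = 1" by (auto simp: B_def)
      then show ?thesis by simp
    next
      case False
      then have "X x = 0" unfolding X_def by (intro sum.neutral) auto
      then show ?thesis by simp
    qed
    moreover have "B x * B x = B x" by (auto simp: B_def of_bool_def)
    moreover have "(X x - Z * B x) * (X x - Z * B x) = X x * X x - 2 * Z * (X x * B x) + Z * Z * (B x * B x)"
      by (simp add: algebra_simps)
    ultimately show ?thesis by (metis zero_le_square)
  qed
  then have "0 \<le> ?E (\<lambda>x. X x * X x - 2 * Z * X x + Z * Z * B x)"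
    by (intro Bochner_Integration.integral_nonneg)
  also have "\<dots> = ?E (\<lambda>x. X x * X x) - 2 * Z * ?E X + Z * Z * ?E B"
    by (simp add: int)
  also have "\<dots> \<le> Z * (Z * ?E B - ?E X)"
    using le by (simp add: EX EX2 algebra_simps)
  finally have "?E X \<le> Z * ?E B" using Z by (simp add: zero_le_mult_iff)
  then show ?thesis using Z by (simp add: EX EB field_simps)
qed

text \<open>The recursion behind the overlap estimate. The potential \<open>x + K * y\<close> grows by a factor of at
most \<open>\<kappa> + K * \<mu>\<close> per step: the assumption on \<open>K\<close> lets the growth rate
\<open>\<kappa>\<close> of \<open>x\<close> absorb the flow from \<open>y\<close> to \<open>x\<close>. As
\<open>K * \<mu> * l\<close> is at most \<open>1/2\<close>, this is \<open>\<kappa> ^ l\<close> up to a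
factor of 2 after \<open>l\<close> steps.\<close>

lemma coupled_growth:
  fixes x y :: "nat \<Rightarrow> real"
  assumes init: "x 0 \<le> 0" "y 0 \<le> 1" and nn: "\<And>t. 0 \<le> x t" "\<And>t. 0 \<le> y t"
    and x: "\<And>t. x (Suc t) \<le> \<kappa> * (x t + y t)" and y: "\<And>t. y (Suc t) \<le> y t + \<mu> * (x t + y t)"
    and K: "1 < \<kappa>" "1 \<le> K" "2 * \<kappa> \<le> K * (\<kappa> - 1)" and mu: "0 \<le> \<mu>" "2 * K * \<mu> * real l \<le> 1" "1 \<le> l"
  shows "x l \<le> 2 * K * \<kappa> ^ l" "y l \<le> 1 + 2 * \<mu> * real l * K * \<kappa> ^ l"
proof -
  define \<rho> where "\<rho> = \<kappa> + K * \<mu>"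
  have "2 * K * \<mu> * 1 \<le> 2 * K * \<mu> * real l" using K mu by (intro mult_left_mono) auto
  then have mu1: "2 * K * \<mu> \<le> 1" using mu(2) by linarith
  have mu2: "2 * \<mu> \<le> \<kappa> - 1"
  proof -
    have "K * (2 * \<mu>) \<le> K * (\<kappa> - 1)" using mu1 K(1,3) by (simp add: algebra_simps)
    then show ?thesis using K(2) by simp
  qed
  have rho1: "1 \<le> \<rho>" using K mu(1) by (simp add: \<rho>_def add_increasing2)
  have u: "x t + K * y t \<le> K * \<rho> ^ t" for t
  proof (induction t)
    case 0
    have "x 0 + K * y 0 \<le> 0 + K * 1" using init K(2) by (intro add_mono mult_left_mono) auto
    then show ?case by simp
  next
    case (Suc t)
    have c: "\<kappa> + K + K * \<mu> \<le> \<rho> * K"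
    proof -
      have "\<kappa> + K + K * \<mu> \<le> K * (\<kappa> - 1) / 2 + K + K * (\<kappa> - 1) / 2"
        using K(2,3) mu2 mult_left_mono[of "2 * \<mu>" "\<kappa> - 1" K] by linarith
      also have "\<dots> = K * \<kappa>" by (simp add: algebra_simps)
      also have "\<dots> \<le> \<rho> * K" using K mu(1) by (simp add: \<rho>_def algebra_simps)
      finally show ?thesis .
    qed
    have "x (Suc t) + K * y (Suc t) \<le> \<kappa> * (x t + y t) + K * (y t + \<mu> * (x t + y t))"
      using x[of t] y[of t] K(2) by (intro add_mono mult_left_mono) auto
    also have "\<dots> = \<rho> * x t + (\<kappa> + K + K * \<mu>) * y t" by (simp add: \<rho>_def algebra_simps)
    also have "\<dots> \<le> \<rho> * x t + (\<rho> * K) * y t" using c nn(2)[of t] by (intro add_left_mono mult_right_mono) auto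
    also have "\<dots> = \<rho> * (x t + K * y t)" by (simp add: algebra_simps)
    also have "\<dots> \<le> \<rho> * (K * \<rho> ^ t)" using Suc rho1 by (intro mult_left_mono) auto
    finally show ?case by (simp add: algebra_simps)
  qed
  have rho: "\<rho> ^ l \<le> 2 * \<kappa> ^ l"
  proof -
    have "\<rho> ^ l \<le> (\<kappa> * (1 + K * \<mu>)) ^ l"
    proof (rule power_mono)
      have "1 * (K * \<mu>) \<le> \<kappa> * (K * \<mu>)" using K mu(1) by (intro mult_right_mono) auto
      then show "\<rho> \<le> \<kappa> * (1 + K * \<mu>)" by (simp add: \<rho>_def algebra_simps)
    qed (use rho1 in simp)
    also have "\<dots> = \<kappa> ^ l * (1 + K * \<mu>) ^ l" by (simp add: power_mult_distrib)
    also have "(1 + K * \<mu>) ^ l \<le> exp (K * \<mu>) ^ l"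
      using K mu(1) by (intro power_mono exp_ge_add_one_self) auto
    also have "exp (K * \<mu>) ^ l = exp (K * \<mu> * real l)" by (simp add: exp_of_nat_mult[symmetric] mult.commute)
    also have "\<dots> \<le> exp (1 / 2)" using mu(2) by simp
    also have "exp (1 / 2 :: real) \<le> 2" using exp_bound_half[of "1/2::real"] by simp
    finally show ?thesis using K(1) by (simp add: mult.commute)
  qed
  have "x l \<le> K * \<rho> ^ l" using u[of l] K(2) nn(2)[of l] by (smt (verit) mult_nonneg_nonneg)
  also have "\<dots> \<le> K * (2 * \<kappa> ^ l)" using rho K(2) by (intro mult_left_mono) auto
  finally show "x l \<le> 2 * K * \<kappa> ^ l" by simp
  have "y t \<le> 1 + \<mu> * real t * (K * \<rho> ^ l)" if "t \<le> l" for t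
    using that
  proof (induction t)
    case 0
    then show ?case using init by simp
  next
    case (Suc t)
    have "x t + y t \<le> x t + K * y t" using K(2) nn(2)[of t] by (simp add: mult_le_cancel_right1)
    also have "\<dots> \<le> K * \<rho> ^ t" by (rule u)
    also have "\<dots> \<le> K * \<rho> ^ l" using K(2) rho1 Suc.prems by (intro mult_left_mono power_increasing) auto
    finally have "\<mu> * (x t + y t) \<le> \<mu> * (K * \<rho> ^ l)" using mu(1) by (rule mult_left_mono)
    then show ?case using y[of t] Suc by (simp add: algebra_simps)
  qed
  from this[of l] have "y l \<le> 1 + \<mu> * real l * (K * \<rho> ^ l)" by simp
  also have "\<dots> \<le> 1 + \<mu> * real l * (K * (2 * \<kappa> ^ l))"
    using rho K(2) mu(1) by (intro add_left_mono mult_left_mono) auto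
  finally show "y l \<le> 1 + 2 * \<mu> * real l * K * \<kappa> ^ l" by (simp add: algebra_simps)
qed

text \<open>Given that the path through \<open>zs\<close> is present, the sum is the expected number of paths through some
\<open>ys\<close> that are present. It exceeds \<open>p * \<kappa> ^ l\<close>, an upper bound for the
unconditional expectation, only by a factor of order \<open>l\<^sup>2\<close>.

To see this, grow the second path vertex by vertex from \<open>a\<close> on and weigh it by the probability of
its new edges. Let \<open>x t\<close> be the weight of the paths with \<open>t\<close> edges that end off the
first path, and \<open>y t\<close> the weight of those that end on it, counted twice if they have just
arrived by a new edge. The double count accounts for the two directions in which such a path can go on along
the first one; a path that already runs along it has only one way to stay, since it does not turn back.
Leaving the first path gains a factor \<open>\<kappa>\<close>, and the edges by which it can be hit have total
weight at most \<open>l * p\<close>.\<close>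

lemma overlap_weight:
  fixes S :: "'v set" and a c :: 'v and zs :: "'v list" and l :: nat
  defines "P \<equiv> path_edges (c # zs @ [a])"
    and "L \<equiv> {ys. length ys = l \<and> distinct ys \<and> set ys \<subseteq> S}"
  assumes S: "finite S" "a \<notin> S" "c \<notin> S" "a \<noteq> c" and zs: "zs \<in> L"
    and p: "0 < p" "p \<le> 1" and lam: "\<kappa> = real (card S) * p"
    and K: "1 < \<kappa>" "1 \<le> K" "2 * \<kappa> \<le> K * (\<kappa> - 1)" and l: "1 \<le> l" "4 * K * (real l)\<^sup>2 * p \<le> 1"
    and big: "1 \<le> p * \<kappa> ^ l"
  shows "(\<Sum>ys\<in>L. p ^ card (path_edges (c # ys @ [a]) - P)) \<le> 12 * K * (real l)\<^sup>2 * (p * \<kappa> ^ l)"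
proof -
  define Q where "Q t = {q. length q = Suc t \<and> distinct q \<and> last q = a \<and> set (butlast q) \<subseteq> S}" for t
  define w where "w q = p ^ card (path_edges q - P)" for q :: "'v list"
  define VP where "VP = insert a (set zs)"
  define g where "g q = (if hd q \<notin> VP then 0 else if length q = 1 \<or> {hd q, hd (tl q)} \<in> P then 1 else (2::nat))" for q
  define x where "x t = (\<Sum>q\<in>Q t. w q * of_bool (hd q \<notin> VP))" for t
  define y where "y t = (\<Sum>q\<in>Q t. w q * real (g q))" for t
  have dz: "distinct (c # zs @ [a])" "length zs = l" "set zs \<subseteq> S" using zs S by (auto simp: L_def)
  have w0: "0 \<le> w q" for q using p by (simp add: w_def)
  have Qset: "set q \<subseteq> insert a S" "q \<noteq> []" "hd q \<in> insert a S" "distinct q" "c \<notin> set q" if "q \<in> Q t" for q t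
  proof -
    have "q \<noteq> []" using that by (auto simp: Q_def)
    moreover have "set q \<subseteq> insert a S"
      using that \<open>q \<noteq> []\<close> by (cases q rule: rev_cases) (auto simp: Q_def)
    ultimately show sub: "set q \<subseteq> insert a S" "q \<noteq> []" by auto
    then show "hd q \<in> insert a S" using hd_in_set[of q] by blast
    show "distinct q" "c \<notin> set q" using that sub S by (auto simp: Q_def)
  qed
  have finQ: "finite (Q t)" for t
  proof (rule finite_subset[OF _ finite_lists_length_eq[of "insert a S" "Suc t"]])
    show "Q t \<subseteq> {xs. set xs \<subseteq> insert a S \<and> length xs = Suc t}"
      using Qset(1) by (fastforce simp: Q_def)
  qed (use S in simp)
  have Q0: "Q 0 = {[a]}" by (auto simp: Q_def length_Suc_conv)
  have QSuc: "Q (Suc t) = (\<lambda>(q, v). v # q) ` (SIGMA q:Q t. S - set q)" for t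
  proof (intro equalityI subsetI)
    fix r assume "r \<in> Q (Suc t)"
    then obtain v q where "r = v # q" "q \<noteq> []" "v \<in> S - set q" "q \<in> Q t"
      by (auto simp: Q_def length_Suc_conv)
    then show "r \<in> (\<lambda>(q, v). v # q) ` (SIGMA q:Q t. S - set q)" by force
  next
    fix r assume "r \<in> (\<lambda>(q, v). v # q) ` (SIGMA q:Q t. S - set q)"
    then obtain q v where r: "r = v # q" "q \<in> Q t" "v \<in> S" "v \<notin> set q" by auto
    moreover have "q \<noteq> []" using r(2) Qset(2) by blast
    ultimately show "r \<in> Q (Suc t)" by (auto simp: Q_def)
  qed
  have sumSuc: "(\<Sum>r\<in>Q (Suc t). F r) = (\<Sum>q\<in>Q t. \<Sum>v\<in>S - set q. F (v # q))" for t and F :: "'v list \<Rightarrow> real"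
  proof -
    let ?X = "SIGMA q:Q t. S - set q"
    have "(\<Sum>r\<in>Q (Suc t). F r) = (\<Sum>z\<in>?X. F (snd z # fst z))"
      unfolding QSuc by (subst sum.reindex) (auto simp: inj_on_def case_prod_unfold)
    also have "\<dots> = (\<Sum>(q, v)\<in>?X. F (v # q))" by (simp add: case_prod_unfold)
    also have "\<dots> = (\<Sum>q\<in>Q t. \<Sum>v\<in>S - set q. F (v # q))"
      using finQ S by (intro sum.Sigma[symmetric]) auto
    finally show ?thesis .
  qed
  have wCons: "w (v # q) = w q * (if {v, hd q} \<in> P then 1 else p)" if "q \<noteq> []" "v \<notin> set q" for v q
  proof -
    have new: "{v, hd q} \<notin> path_edges q" using new_edge[OF that(2)] .
    show ?thesis
    proof (cases "{v, hd q} \<in> P")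
      case True
      then have "path_edges (v # q) - P = path_edges q - P"
        unfolding path_edges_Cons[OF that(1)] by blast
      then show ?thesis using True by (simp add: w_def)
    next
      case False
      then have "path_edges (v # q) - P = insert {v, hd q} (path_edges q - P)"
        unfolding path_edges_Cons[OF that(1)] by blast
      then show ?thesis using False new by (simp add: w_def)
    qed
  qed
  have inP: "u \<in> VP \<or> u = c" if "{v, u} \<in> P \<or> {u, v} \<in> P" for u v
  proof -
    have "{u, v} \<in> P" using that by (metis insert_commute)
    then have "{u, v} \<subseteq> set (c # zs @ [a])" unfolding P_def by (rule path_edges_subset)
    then show ?thesis by (auto simp: VP_def)
  qed
  have finN: "finite {v. {v, u} \<in> P}" for u
  proof (rule finite_subset)
    show "{v. {v, u} \<in> P} \<subseteq> insert c VP" using inP by blast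
  qed (simp add: VP_def)
  \<comment> \<open>The weight \<open>g\<close> bounds the number of edges of the first path along which the second one can be continued.\<close>
  have avail: "card {v \<in> S - set q. {v, hd q} \<in> P} \<le> g q" if q: "q \<in> Q t" for q t
  proof -
    let ?A = "{v \<in> S - set q. {v, hd q} \<in> P}" and ?N = "{v. {v, hd q} \<in> P}"
    have sub: "?A \<subseteq> ?N" by auto
    have deg: "card ?N \<le> 2" using path_nbrs[OF dz(1), of "hd q"] by (simp add: P_def)
    consider "hd q \<notin> VP" | "hd q \<in> VP" "length q = 1" | "hd q \<in> VP" "length q \<noteq> 1" "{hd q, hd (tl q)} \<in> P"
      | "hd q \<in> VP" "length q \<noteq> 1" "{hd q, hd (tl q)} \<notin> P" by blast
    then show ?thesis
    proof cases
      case 1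
      then have "{v, hd q} \<notin> P" for v using inP[of v "hd q"] Qset(3)[OF q] S(3,4) by auto
      then show ?thesis by simp
    next
      case 2
      then obtain z where "q = [z]" by (cases q) auto
      then have "hd q = a" using q by (simp add: Q_def)
      then have "card ?N \<le> 1" using path_nbrs[OF dz(1), of a] by (simp add: P_def)
      then show ?thesis using 2 card_mono[OF finN sub] by (simp add: g_def)
    next
      case 3
      obtain z z' r where "q = z # z' # r"
        using 3(2) Qset(2)[OF q] by (cases q; cases "tl q") auto
      then have "hd (tl q) \<in> set q" "hd (tl q) \<in> ?N"
        using 3(3) by (simp_all add: insert_commute)
      then have "card ?A < card ?N" using sub by (intro psubset_card_mono finN) auto
      then show ?thesis using 3 deg by (simp add: g_def)
    next
      case 4
      then show ?thesis using card_mono[OF finN sub] deg by (simp add: g_def)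
    qed
  qed
  define s where "s t = (\<Sum>q\<in>Q t. w q)" for t
  have s: "s t \<le> x t + y t" for t
    unfolding s_def x_def y_def sum.distrib[symmetric]
    by (intro sum_mono) (auto simp: g_def w0)
  have x_step: "x (Suc t) \<le> \<kappa> * (x t + y t)" for t
  proof -
    have "x (Suc t) = (\<Sum>q\<in>Q t. \<Sum>v\<in>S - set q. w (v # q) * of_bool (v \<notin> VP))"
      unfolding x_def sumSuc by simp
    also have "\<dots> \<le> (\<Sum>q\<in>Q t. w q * \<kappa>)"
    proof (intro sum_mono)
      fix q assume q: "q \<in> Q t"
      have "(\<Sum>v\<in>S - set q. w (v # q) * of_bool (v \<notin> VP)) \<le> (\<Sum>v\<in>S - set q. w q * p)"
      proof (intro sum_mono)
        fix v assume v: "v \<in> S - set q"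
        then have "{v, hd q} \<notin> P" if "v \<notin> VP" using inP[of "hd q" v] that S by auto
        then show "w (v # q) * of_bool (v \<notin> VP) \<le> w q * p"
          using v Qset(2)[OF q] w0 p by (auto simp: wCons)
      qed
      also have "\<dots> = real (card (S - set q)) * (w q * p)" by simp
      also have "\<dots> \<le> real (card S) * (w q * p)"
        using w0 p S by (intro mult_right_mono) (auto intro: card_mono)
      finally show "(\<Sum>v\<in>S - set q. w (v # q) * of_bool (v \<notin> VP)) \<le> w q * \<kappa>" by (simp add: lam mult_ac)
    qed
    also have "\<dots> = \<kappa> * s t" by (simp add: s_def sum_distrib_left mult.commute)
    also have "\<dots> \<le> \<kappa> * (x t + y t)" using s K(1) by (intro mult_left_mono) auto
    finally show ?thesis .
  qed
  have y_step: "y (Suc t) \<le> y t + (2 * real l * p) * (x t + y t)" for t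
  proof -
    have "y (Suc t) = (\<Sum>q\<in>Q t. \<Sum>v\<in>S - set q. w (v # q) * real (g (v # q)))"
      unfolding y_def sumSuc by simp
    also have "\<dots> \<le> (\<Sum>q\<in>Q t. w q * real (g q) + (2 * real l * p) * w q)"
    proof (intro sum_mono)
      fix q assume q: "q \<in> Q t"
      have "(\<Sum>v\<in>S - set q. w (v # q) * real (g (v # q))) \<le>
            (\<Sum>v\<in>S - set q. w q * of_bool ({v, hd q} \<in> P) + 2 * p * w q * of_bool (v \<in> set zs))"
      proof (intro sum_mono)
        fix v assume v: "v \<in> S - set q"
        then have "v \<in> VP \<longleftrightarrow> v \<in> set zs" using S by (auto simp: VP_def)
        then show "w (v # q) * real (g (v # q)) \<le> w q * of_bool ({v, hd q} \<in> P) + 2 * p * w q * of_bool (v \<in> set zs)"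
          using v Qset(2)[OF q] w0[of q] p by (auto simp: wCons g_def)
      qed
      also have "\<dots> = w q * real (card {v \<in> S - set q. {v, hd q} \<in> P}) + 2 * p * w q * real (card ((S - set q) \<inter> set zs))"
        using S by (simp add: sum.distrib sum_distrib_left[symmetric] Int_def conj_commute)
      also have "\<dots> \<le> w q * real (g q) + 2 * p * w q * real l"
      proof (intro add_mono mult_left_mono)
        show "real (card ((S - set q) \<inter> set zs)) \<le> real l"
          using card_mono[of "set zs" "(S - set q) \<inter> set zs"] card_length[of zs] dz by auto
      qed (use avail[OF q] w0 p in auto)
      finally show "(\<Sum>v\<in>S - set q. w (v # q) * real (g (v # q))) \<le> w q * real (g q) + (2 * real l * p) * w q"
        by (simp add: mult_ac)
    qed
    also have "\<dots> = y t + (2 * real l * p) * s t"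
      by (simp add: sum.distrib y_def s_def sum_distrib_left)
    also have "\<dots> \<le> y t + (2 * real l * p) * (x t + y t)"
      using s p by (intro add_left_mono mult_left_mono) auto
    finally show ?thesis .
  qed
  have a0: "x 0 \<le> 0" "y 0 \<le> 1"
    by (auto simp: x_def y_def Q0 VP_def g_def w_def)
  have nn: "0 \<le> x t" "0 \<le> y t" for t
    by (auto simp: x_def y_def w0 intro!: sum_nonneg)
  have mu: "2 * K * (2 * real l * p) * real l \<le> 1" "0 \<le> 2 * real l * p"
    using l p by (auto simp: power2_eq_square mult_ac)
  note growth = coupled_growth[OF a0 nn x_step y_step K mu(2,1) l(1)]
  have LQ: "(\<lambda>ys. ys @ [a]) ` L = Q l"
  proof (intro equalityI subsetI)
    fix q assume "q \<in> Q l"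
    then show "q \<in> (\<lambda>ys. ys @ [a]) ` L"
      by (cases q rule: rev_cases) (auto simp: Q_def L_def)
  qed (use S in \<open>auto simp: Q_def L_def\<close>)
  have "(\<Sum>ys\<in>L. p ^ card (path_edges (c # ys @ [a]) - P)) = (\<Sum>ys\<in>L. w (c # (ys @ [a])))"
    by (simp add: w_def)
  also have "\<dots> = (\<Sum>q\<in>Q l. w (c # q))"
    unfolding LQ[symmetric] by (subst sum.reindex) (auto simp: inj_on_def)
  also have "\<dots> \<le> (\<Sum>q\<in>Q l. p * w q + w q * real (g q))"
  proof (intro sum_mono)
    fix q assume q: "q \<in> Q l"
    have "hd q \<in> VP" if "{c, hd q} \<in> P" using inP[of c "hd q"] that Qset[OF q] S by auto
    then show "w (c # q) \<le> p * w q + w q * real (g q)"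
      using Qset[OF q] w0[of q] p by (auto simp: wCons g_def)
  qed
  also have "\<dots> = p * s l + y l" by (simp add: sum.distrib s_def y_def sum_distrib_left)
  also have "\<dots> \<le> p * (x l + y l) + y l" using s p by simp
  also have "\<dots> \<le> p * x l + 2 * y l" using p nn(2)[of l] mult_right_mono[of p 1 "y l"] by (simp add: algebra_simps)
  also have "\<dots> \<le> p * (2 * K * \<kappa> ^ l) + 2 * (1 + 2 * (2 * real l * p) * real l * K * \<kappa> ^ l)"
    using growth p by (intro add_mono mult_left_mono) auto
  also have "\<dots> = (2 * K + 8 * K * (real l)\<^sup>2) * (p * \<kappa> ^ l) + 2 * 1"
    by (simp add: algebra_simps power2_eq_square)
  also have "\<dots> \<le> (2 * K + 8 * K * (real l)\<^sup>2) * (p * \<kappa> ^ l) + 2 * (p * \<kappa> ^ l)"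
    using big by linarith
  also have "\<dots> = (2 * K + 8 * K * (real l)\<^sup>2 + 2) * (p * \<kappa> ^ l)" by (simp add: algebra_simps)
  also have "\<dots> \<le> (12 * K * (real l)\<^sup>2) * (p * \<kappa> ^ l)"
  proof (rule mult_right_mono)
    have "1 \<le> (real l)\<^sup>2" using l(1) by simp
    then have "K * 1 \<le> K * (real l)\<^sup>2" using K(2) by (intro mult_left_mono) auto
    then show "2 * K + 8 * K * (real l)\<^sup>2 + 2 \<le> 12 * K * (real l)\<^sup>2"
      using K(2) unfolding mult.assoc by linarith
  qed (use big in linarith)
  finally show ?thesis .
qed

text \<open>The second moment bound for the number of paths with \<open>l\<close> inner vertices. The assumption
\<open>1 \<le> p * \<kappa> ^ l\<close> says that at least about one such path is expected; then the
events overlap so little that the loss is only a factor of order \<open>l\<^sup>2\<close>.\<close>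

lemma prob_joined_through:
  fixes S :: "'v set" and a c :: 'v
  assumes I: "finite I" "\<And>u v. u \<in> insert a (insert c S) \<Longrightarrow> v \<in> S \<Longrightarrow> u \<noteq> v \<Longrightarrow> {u, v} \<in> I"
    and S: "finite S" "a \<notin> S" "c \<notin> S" "a \<noteq> c"
    and p: "0 < p" "p \<le> 1" and lam: "\<kappa> = real (card S) * p"
    and K: "1 < \<kappa>" "1 \<le> K" "2 * \<kappa> \<le> K * (\<kappa> - 1)" and l: "1 \<le> l" "4 * K * (real l)\<^sup>2 * p \<le> 1"
    and big: "1 \<le> p * \<kappa> ^ l" and m: "2 * l\<^sup>2 \<le> card S"
  shows "1 / (24 * K * (real l)\<^sup>2) \<le> prob (coins I p) (\<lambda>f. joined_through {e \<in> I. f e} S c a)"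
proof -
  define L where "L = {ys. length ys = l \<and> distinct ys \<and> set ys \<subseteq> S}"
  define F where "F ys = path_edges (c # ys @ [a])" for ys
  define Z where "Z = 12 * K * (real l)\<^sup>2 * (p * \<kappa> ^ l)"
  let ?m = "card S"
  have Z: "Z > 0" using K l p by (simp add: Z_def)
  have finL: "finite L"
    by (rule finite_subset[OF _ finite_lists_length_eq[of S l]]) (use S in \<open>auto simp: L_def\<close>)
  have dis: "distinct (c # ys @ [a])" if "ys \<in> L" for ys using that S by (auto simp: L_def)
  have FI: "F ys \<subseteq> I" if ys: "ys \<in> L" for ys
  proof
    fix e assume e: "e \<in> F ys"
    obtain u v where uv: "e = {u, v}" "u \<noteq> v"
      using path_edgesE[OF _ dis[OF ys]] e unfolding F_def by blast
    have sub: "e \<subseteq> insert c (insert a S)"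
      using path_edges_subset[of e] e ys by (fastforce simp: F_def L_def)
    have "e \<noteq> {c, a}"
    proof
      assume "e = {c, a}"
      moreover obtain z zs where "ys = z # zs" "z \<in> S" using ys l(1) by (cases ys) (auto simp: L_def)
      moreover have "{c, a} \<notin> path_edges (z # zs @ [a])" if "ys = z # zs"
        using dis[OF ys] that by (intro new_edge) auto
      ultimately show False using e S by (auto simp: F_def doubleton_eq_iff)
    qed
    then have "u \<in> S \<or> v \<in> S" using sub uv by auto
    then show "e \<in> I" using I(2)[of u v] I(2)[of v u] sub uv by (auto simp: insert_commute)
  qed
  have pr: "prob (coins I p) (\<lambda>f. \<forall>e\<in>G. f e) = p ^ card G" if "G \<subseteq> I" for G
    using prob_pattern[OF I(1) that, of "{}" p] p by simp
  have one: "prob (coins I p) (\<lambda>f. \<forall>e\<in>F ys. f e) = p ^ Suc l" if "ys \<in> L" for ys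
    using that pr[OF FI] card_path_edges[OF dis[OF that]] by (simp add: F_def L_def)
  have two: "prob (coins I p) (\<lambda>f. (\<forall>e\<in>F zs. f e) \<and> (\<forall>e\<in>F ys. f e)) = p ^ Suc l * p ^ card (F ys - F zs)"
    if "zs \<in> L" "ys \<in> L" for ys zs
  proof -
    have "prob (coins I p) (\<lambda>f. (\<forall>e\<in>F zs. f e) \<and> (\<forall>e\<in>F ys. f e)) = prob (coins I p) (\<lambda>f. \<forall>e\<in>F zs \<union> F ys. f e)"
      by (intro arg_cong[of _ _ "measure_pmf.prob _"]) auto
    also have "\<dots> = p ^ card (F zs \<union> F ys)" using FI that by (intro pr) auto
    also have "card (F zs \<union> F ys) = card (F zs) + card (F ys - F zs)"
      by (subst Un_Diff_cancel[symmetric], subst card_Un_disjoint) (auto simp: F_def)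
    also have "card (F zs) = Suc l"
      using that card_path_edges[OF dis[OF that(1)]] by (simp add: F_def L_def)
    finally show ?thesis by (simp add: power_add)
  qed
  have "(\<Sum>zs\<in>L. \<Sum>ys\<in>L. prob (coins I p) (\<lambda>f. (\<forall>e\<in>F zs. f e) \<and> (\<forall>e\<in>F ys. f e))) =
        (\<Sum>zs\<in>L. p ^ Suc l * (\<Sum>ys\<in>L. p ^ card (F ys - F zs)))"
    by (simp add: two sum_distrib_left)
  also have "\<dots> \<le> (\<Sum>zs\<in>L. p ^ Suc l * Z)"
    using overlap_weight[OF S _ p lam K l big] p
    by (intro sum_mono mult_left_mono) (auto simp: F_def Z_def L_def)
  also have "\<dots> = Z * (\<Sum>zs\<in>L. prob (coins I p) (\<lambda>f. \<forall>e\<in>F zs. f e))"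
    by (simp add: one sum_distrib_left mult.commute)
  finally have sm: "(\<Sum>zs\<in>L. prob (coins I p) (\<lambda>f. \<forall>e\<in>F zs. f e)) / Z \<le> prob (coins I p) (\<lambda>f. \<exists>zs\<in>L. \<forall>e\<in>F zs. f e)"
    by (intro second_moment finite_coins I finL Z)
  have count: "p * \<kappa> ^ l / 2 \<le> (\<Sum>zs\<in>L. prob (coins I p) (\<lambda>f. \<forall>e\<in>F zs. f e))"
  proof -
    have lm: "l \<le> ?m" using m l(1) by (metis le_square power2_eq_square le_trans mult_2 trans_le_add1)
    have cardL: "card L = \<Prod>{?m - l + 1..?m}"
      using card_lists_distinct_length_eq[OF S(1) lm] by (simp add: L_def)
    have "(?m - l) ^ l \<le> \<Prod>{?m - l + 1..?m}"
    proof -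
      have "(\<Prod>i\<in>{?m - l + 1..?m}. ?m - l) \<le> \<Prod>{?m - l + 1..?m}" by (rule prod_mono) auto
      then show ?thesis using lm by simp
    qed
    then have cL: "real (?m - l) ^ l \<le> real (card L)" unfolding cardL by (metis of_nat_le_iff of_nat_power)
    have m0: "real ?m > 0" using lm l(1) by linarith
    have "1 / 2 \<le> 1 - real l * (real l / real ?m)"
    proof -
      have "2 * (real l)\<^sup>2 \<le> real ?m" using m by (metis of_nat_le_iff of_nat_mult of_nat_numeral of_nat_power)
      then show ?thesis using m0 by (simp add: field_simps power2_eq_square)
    qed
    also have "\<dots> \<le> (1 - real l / real ?m) ^ l"
      using Bernoulli_inequality[of "- (real l / real ?m)" l] lm m0 by simp
    finally have half: "1 / 2 \<le> (1 - real l / real ?m) ^ l" .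
    have "p * \<kappa> ^ l / 2 = p * \<kappa> ^ l * (1 / 2)" by simp
    also have "\<dots> \<le> p * \<kappa> ^ l * (1 - real l / real ?m) ^ l"
      using half p K(1) by (intro mult_left_mono) auto
    also have "\<dots> = p * (real (?m - l) * p) ^ l"
    proof -
      have "\<kappa> * (1 - real l / real ?m) = real (?m - l) * p"
        using m0 lm by (simp add: lam field_simps of_nat_diff)
      then show ?thesis by (metis (no_types) mult.assoc power_mult_distrib)
    qed
    also have "\<dots> = p ^ Suc l * real (?m - l) ^ l" by (simp add: power_mult_distrib)
    also have "\<dots> \<le> p ^ Suc l * real (card L)" using cL p by (intro mult_left_mono) auto
    also have "\<dots> = (\<Sum>zs\<in>L. prob (coins I p) (\<lambda>f. \<forall>e\<in>F zs. f e))" by (simp add: one)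
    finally show ?thesis .
  qed
  have "1 / (24 * K * (real l)\<^sup>2) = (p * \<kappa> ^ l / 2) / Z"
    using p K by (simp add: Z_def field_simps)
  also have "\<dots> \<le> (\<Sum>zs\<in>L. prob (coins I p) (\<lambda>f. \<forall>e\<in>F zs. f e)) / Z"
    using count Z by (intro divide_right_mono) auto
  also note sm
  also have "prob (coins I p) (\<lambda>f. \<exists>zs\<in>L. \<forall>e\<in>F zs. f e) \<le> prob (coins I p) (\<lambda>f. joined_through {e \<in> I. f e} S c a)"
  proof (intro measure_pmf.finite_measure_mono subsetI)
    fix f assume "f \<in> {f. \<exists>zs\<in>L. \<forall>e\<in>F zs. f e}"
    then obtain zs where zs: "zs \<in> L" "\<forall>e\<in>F zs. f e" by auto
    then have "successively (adj {e \<in> I. f e}) (c # zs @ [a])"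
      using FI[OF zs(1)] by (intro successively_adj_path_edges dis) (auto simp: F_def)
    then show "f \<in> {f. joined_through {e \<in> I. f e} S c a}"
      using zs(1) l(1) by (auto simp: joined_through_def L_def intro!: exI[of _ zs])
  qed simp
  finally show ?thesis .
qed

section \<open>Filling squares and splitting pentagons in a random graph\<close>

definition pairs :: "'v set \<Rightarrow> 'v set set" where
  "pairs V = {e. e \<subseteq> V \<and> card e = 2}"

abbreviation graph :: "'v set \<Rightarrow> ('v set \<Rightarrow> bool) \<Rightarrow> 'v set set" where
  "graph V f \<equiv> {e \<in> pairs V. f e}"

lemma finite_pairs: "finite V \<Longrightarrow> finite (pairs V)"
  unfolding pairs_def by (rule finite_subset[of _ "Pow V"]) auto

lemma doubleton_in_pairs: "{u, v} \<in> pairs V \<longleftrightarrow> u \<noteq> v \<and> u \<in> V \<and> v \<in> V"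
  by (auto simp: pairs_def card_insert_if)

lemma adj_graph: "adj (graph V f) u v \<longleftrightarrow> u \<noteq> v \<and> u \<in> V \<and> v \<in> V \<and> f {u, v}"
  by (auto simp: adj_def doubleton_in_pairs)

lemma prob_mono: "(\<And>x. A x \<Longrightarrow> B x) \<Longrightarrow> prob P A \<le> prob P B"
  by (intro measure_pmf.finite_measure_mono) auto

lemma prob_disj_le: "prob P (\<lambda>x. A x \<or> B x) \<le> prob P A + prob P B"
proof -
  have "{x. A x \<or> B x} = {x. A x} \<union> {x. B x}" by auto
  then show ?thesis by (simp add: measure_Un_le)
qed

lemma prob_Bex_le: "finite J \<Longrightarrow> prob P (\<lambda>x. \<exists>j\<in>J. A j x) \<le> (\<Sum>j\<in>J. prob P (A j))"
proof -
  assume J: "finite J"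
  have "{x. \<exists>j\<in>J. A j x} = (\<Union>j\<in>J. {x. A j x})" by auto
  then show ?thesis using J by (simp add: measure_UNION_le)
qed

definition common_in :: "('v set \<Rightarrow> bool) \<Rightarrow> 'v set \<Rightarrow> 'v \<Rightarrow> 'v \<Rightarrow> 'v set" where
  "common_in f U x y = {w \<in> U. f {w, x} \<and> f {w, y}}"

lemma few_common_neighbours:
  fixes V :: "'a set"
  assumes V: "finite V" "x \<in> V" "y \<in> V" "x \<noteq> y" and U: "U \<subseteq> V - {x, y}" and p: "0 \<le> p" "p \<le> 1"
  shows "prob (coins (pairs V) p) (\<lambda>f. real (card (common_in f U x y)) \<le> p\<^sup>2 * real (card U) / 2)
         \<le> exp (- (p\<^sup>2 * real (card U) / 8))"
proof -
  let ?B = "\<lambda>w. {{w, x}, {w, y}}"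
  have fU: "finite U" using V U finite_subset by blast
  have dis: "disjoint_family_on ?B U"
    unfolding disjoint_family_on_def using U by (auto simp: doubleton_eq_iff)
  have pr: "p\<^sup>2 \<le> prob (coins (pairs V) p) (\<lambda>f. f {w, x} \<and> f {w, y})" if w: "w \<in> U" for w
  proof -
    have "prob (coins (pairs V) p) (\<lambda>f. (\<forall>e\<in>?B w. f e) \<and> (\<forall>e\<in>{}. \<not> f e)) = p ^ card (?B w) * (1 - p) ^ card ({} :: 'a set set)"
      using w U V by (intro prob_pattern finite_pairs p) (auto simp: doubleton_in_pairs)
    moreover have "card (?B w) = 2" using V(4) by (simp add: doubleton_eq_iff card_insert_if)
    ultimately show ?thesis by simp
  qed
  have "prob (coins (pairs V) p) (\<lambda>f. real (card {w\<in>U. f {w, x} \<and> f {w, y}}) \<le> (1 - 1/2) * p\<^sup>2 * real (card U))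
      \<le> exp (- (p\<^sup>2) * real (card U) * (1/2)\<^sup>2 / 2)"
    by (rule lower_tail[OF finite_pairs[OF V(1)] fU _ dis pr]) (auto simp: determined_by_def)
  then show ?thesis by (simp add: common_in_def power2_eq_square)
qed

text \<open>The common neighbours of \<open>r, u\<close> in \<open>U\<close> and of \<open>r, v\<close> in
\<open>U'\<close> are revealed first. The pairs formed by one of each are then untouched coins, and with
\<open>k\<close> vertices on both sides all of them fail with probability at most
\<open>(1 - p) ^ k\<^sup>2\<close>.\<close>

lemma prob_not_splits_pentagon:
  fixes V :: "'a set"
  assumes V: "finite V" "{r, u, v} \<subseteq> V" "distinct [r, u, v]"
    and U: "U \<subseteq> V - {r, u, v}" "U' \<subseteq> V - {r, u, v}" "U \<inter> U' = {}"
    and k: "real k \<le> p\<^sup>2 * real (card U) / 2" "card U' = card U"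
    and p: "0 \<le> p" "p \<le> 1"
  shows "prob (coins (pairs V) p) (\<lambda>f. \<not> splits_pentagon (graph V f) r u v)
         \<le> 2 * exp (- (p\<^sup>2 * real (card U) / 8)) + exp (- (p * (real k)\<^sup>2))"
proof -
  let ?P = "coins (pairs V) p" and ?t = "p\<^sup>2 * real (card U) / 2"
  let ?W = "\<lambda>f. common_in f U r u" and ?W' = "\<lambda>f. common_in f U' r v"
  define Q where "Q f g \<longleftrightarrow> k \<le> card (?W f) \<and> k \<le> card (?W' f) \<and> (\<forall>w\<in>?W f. \<forall>w'\<in>?W' f. \<not> g {w, w'})" for f g
  let ?A = "{e. e \<inter> {r, u, v} \<noteq> {}}"
  have fin: "finite U" "finite U'" using V U finite_subset by blast+
  have "prob ?P (\<lambda>f. \<not> splits_pentagon (graph V f) r u v) \<le>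
        prob ?P (\<lambda>f. (real (card (?W f)) \<le> ?t \<or> real (card (?W' f)) \<le> ?t) \<or> Q f f)"
  proof (rule prob_mono, rule ccontr)
    fix f assume f: "\<not> splits_pentagon (graph V f) r u v"
      and n: "\<not> ((real (card (?W f)) \<le> ?t \<or> real (card (?W' f)) \<le> ?t) \<or> Q f f)"
    then have "k \<le> card (?W f)" "k \<le> card (?W' f)" using k(1) by linarith+
    then obtain w w' where w: "w \<in> ?W f" "w' \<in> ?W' f" "f {w, w'}" using n by (auto simp: Q_def)
    then have "w \<in> U" "w' \<in> U'" by (auto simp: common_in_def)
    then have m: "w \<in> V - {r, u, v}" "w' \<in> V - {r, u, v}" "w \<noteq> w'" using U by auto
    have "splits_pentagon (graph V f) r u v"
      unfolding splits_pentagon_def common_nbrs_def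
      using w m V by (intro bexI[of _ w] bexI[of _ w']) (auto simp: adj_graph common_in_def)
    then show False using f by simp
  qed
  also have "\<dots> \<le> prob ?P (\<lambda>f. real (card (?W f)) \<le> ?t) + prob ?P (\<lambda>f. real (card (?W' f)) \<le> ?t) + prob ?P (\<lambda>f. Q f f)"
    by (intro order_trans[OF prob_disj_le] add_mono prob_disj_le order_refl)
  also have "prob ?P (\<lambda>f. real (card (?W f)) \<le> ?t) \<le> exp (- (p\<^sup>2 * real (card U) / 8))"
    using V U p by (intro few_common_neighbours) auto
  also have "prob ?P (\<lambda>f. real (card (?W' f)) \<le> ?t) \<le> exp (- (p\<^sup>2 * real (card U) / 8))"
    unfolding k(2)[symmetric] using V U p by (intro few_common_neighbours) auto
  also have "prob ?P (\<lambda>f. Q f f) \<le> exp (- (p * (real k)\<^sup>2))"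
  proof (rule prob_two_stage_le[OF finite_pairs[OF V(1)], where A = ?A and Q = Q])
    fix g
    show "determined_by ?A (\<lambda>f. Q f g)"
      unfolding determined_by_def
    proof (intro allI impI)
      fix f f' :: "'a set \<Rightarrow> bool" assume e: "\<forall>e\<in>?A. f e = f' e"
      then have "?W f = ?W f'" "?W' f = ?W' f'" by (auto simp: common_in_def)
      then show "Q f g = Q f' g" by (simp add: Q_def)
    qed
  next
    fix f
    show "determined_by (- ?A) (Q f)"
      unfolding determined_by_def
    proof (intro allI impI)
      fix g g' :: "'a set \<Rightarrow> bool" assume e: "\<forall>e\<in>- ?A. g e = g' e"
      have "g {w, w'} = g' {w, w'}" if "w \<in> ?W f" "w' \<in> ?W' f" for w w'
        using that U e by (auto simp: common_in_def)
      then show "Q f g = Q f g'" by (auto simp: Q_def)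
    qed
  next
    fix f
    show "prob ?P (Q f) \<le> exp (- (p * (real k)\<^sup>2))"
    proof (cases "k \<le> card (?W f) \<and> k \<le> card (?W' f)")
      case False
      then have "{g. Q f g} = {}" by (auto simp: Q_def)
      then show ?thesis by simp
    next
      case True
      let ?G = "(\<lambda>(w, w'). {w, w'}) ` (?W f \<times> ?W' f)"
      have sub: "?W f \<subseteq> U" "?W' f \<subseteq> U'" by (auto simp: common_in_def)
      have "inj_on (\<lambda>(w, w'). {w, w'}) (?W f \<times> ?W' f)"
        using sub U(3) by (auto simp: inj_on_def doubleton_eq_iff)
      then have "card ?G = card (?W f) * card (?W' f)" by (simp add: card_image card_cartesian_product)
      then have G: "k * k \<le> card ?G" using True by (simp add: mult_le_mono)
      have "?W f \<subseteq> V" "?W' f \<subseteq> V" "?W f \<inter> ?W' f = {}" using sub U by blast+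
      then have "?G \<subseteq> pairs V" by (fastforce simp: doubleton_in_pairs)
      then have "prob ?P (\<lambda>g. (\<forall>e\<in>{}. g e) \<and> (\<forall>e\<in>?G. \<not> g e)) = p ^ card ({} :: 'a set set) * (1 - p) ^ card ?G"
        by (intro prob_pattern finite_pairs V p) auto
      moreover have "prob ?P (Q f) \<le> prob ?P (\<lambda>g. (\<forall>e\<in>{}. g e) \<and> (\<forall>e\<in>?G. \<not> g e))"
        by (rule prob_mono) (auto simp: Q_def)
      ultimately have "prob ?P (Q f) \<le> (1 - p) ^ card ?G" by simp
      also have "\<dots> \<le> (1 - p) ^ (k * k)" using G p by (intro power_decreasing) auto
      also have "\<dots> \<le> exp (- p) ^ (k * k)"
        using p exp_ge_add_one_self[of "- p"] by (intro power_mono) auto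
      also have "\<dots> = exp (- (p * (real k)\<^sup>2))"
        by (simp add: exp_of_nat_mult[symmetric] power2_eq_square mult_ac)
      finally show ?thesis .
    qed
  qed
  finally show ?thesis by simp
qed

text \<open>The common neighbours of \<open>x\<close> and \<open>w\<close> that see neither \<open>y\<close> nor any other
candidate in \<open>W\<close>. For different \<open>w\<close>, and for exchanged \<open>x\<close> and
\<open>y\<close>, these sets are disjoint; as long as \<open>p * card W\<close> is small, exclusivity costs
almost no vertices.\<close>

definition exclusive_nbrs :: "('v set \<Rightarrow> bool) \<Rightarrow> 'v set \<Rightarrow> 'v set \<Rightarrow> 'v \<Rightarrow> 'v \<Rightarrow> 'v \<Rightarrow> 'v set" where
  "exclusive_nbrs f V\<^sub>1 W x y w =
     {v \<in> V\<^sub>1. f {v, x} \<and> f {v, w} \<and> \<not> f {v, y} \<and> (\<forall>w'\<in>W - {w}. \<not> f {v, w'})}"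

lemma exclusive_nbrs_cong:
  assumes "\<And>v z. v \<in> V\<^sub>1 \<Longrightarrow> z \<in> insert x (insert y W) \<Longrightarrow> f {v, z} = g {v, z}" "w \<in> W"
  shows "exclusive_nbrs f V\<^sub>1 W x y w = exclusive_nbrs g V\<^sub>1 W x y w"
  unfolding exclusive_nbrs_def using assms by (intro Collect_cong conj_cong ball_cong refl) simp_all

lemma few_exclusive_nbrs:
  fixes V :: "'a set"
  assumes V: "finite V" "x \<in> V" "y \<in> V" "x \<noteq> y" and V1: "V\<^sub>1 \<subseteq> V - {x, y} - W"
    and W: "W \<subseteq> V - {x, y}" "w \<in> W" "card W = k" and p: "0 \<le> p" "p \<le> 1" and \<delta>: "0 \<le> \<delta>"
  shows "prob (coins (pairs V) p) (\<lambda>f. real (card (exclusive_nbrs f V\<^sub>1 W x y w)) \<le> (1 - \<delta>) * (p\<^sup>2 * (1 - p) ^ k) * real (card V\<^sub>1))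
         \<le> exp (- (p\<^sup>2 * (1 - p) ^ k) * real (card V\<^sub>1) * \<delta>\<^sup>2 / 2)"
proof -
  let ?F = "\<lambda>v. {{v, x}, {v, w}}" and ?G = "\<lambda>v. (\<lambda>z. {v, z}) ` (insert y (W - {w}))"
  let ?A = "\<lambda>v f. f {v, x} \<and> f {v, w} \<and> \<not> f {v, y} \<and> (\<forall>w'\<in>W - {w}. \<not> f {v, w'})"
  have fV1: "finite V\<^sub>1" and fW: "finite W" using V V1 W finite_subset[of _ V] by blast+
  have dis: "disjoint_family_on (\<lambda>v. ?F v \<union> ?G v) V\<^sub>1"
    unfolding disjoint_family_on_def using V1 W by (auto simp: doubleton_eq_iff)
  have pr: "p\<^sup>2 * (1 - p) ^ k \<le> prob (coins (pairs V) p) (?A v)" if v: "v \<in> V\<^sub>1" for v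
  proof -
    have "prob (coins (pairs V) p) (\<lambda>f. (\<forall>e\<in>?F v. f e) \<and> (\<forall>e\<in>?G v. \<not> f e)) = p ^ card (?F v) * (1 - p) ^ card (?G v)"
      using v V1 V W by (intro prob_pattern finite_pairs p) (auto simp: doubleton_in_pairs doubleton_eq_iff)
    moreover have "card (?F v) = 2" using v W by (auto simp: doubleton_eq_iff card_insert_if)
    moreover have "card (?G v) = k"
    proof -
      have "inj_on (\<lambda>z. {v, z}) (insert y (W - {w}))" by (auto simp: inj_on_def doubleton_eq_iff)
      moreover have "card (insert y (W - {w})) = k"
      proof -
        have "y \<notin> W - {w}" using W(1) by blast
        then show ?thesis using W(3) fW card_Suc_Diff1[OF fW W(2)] by simp
      qed
      ultimately show ?thesis by (simp only: card_image)
    qed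
    ultimately show ?thesis by (simp add: conj_assoc)
  qed
  have "prob (coins (pairs V) p) (\<lambda>f. real (card {v\<in>V\<^sub>1. ?A v f}) \<le> (1 - \<delta>) * (p\<^sup>2 * (1 - p) ^ k) * real (card V\<^sub>1))
      \<le> exp (- (p\<^sup>2 * (1 - p) ^ k) * real (card V\<^sub>1) * \<delta>\<^sup>2 / 2)"
    by (rule lower_tail[OF finite_pairs[OF V(1)] fV1 _ dis pr]) (use p \<delta> in \<open>auto simp: determined_by_def\<close>)
  then show ?thesis by (simp add: exclusive_nbrs_def)
qed

lemma joined_through_iff:
  "joined_through E S a c \<longleftrightarrow>
     (\<exists>xs. xs \<noteq> [] \<and> set xs \<subseteq> S \<and> adj E a (hd xs) \<and> successively (adj E) xs \<and> adj E (last xs) c)"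
  unfolding joined_through_def
  by (intro ex_cong1) (auto simp: successively_append_iff successively_Cons)

lemma joined_through_mono:
  assumes "joined_through E S a c" "E \<subseteq> E'" "S \<subseteq> S'"
  shows "joined_through E' S' a c"
proof -
  obtain xs where "xs \<noteq> []" "set xs \<subseteq> S" "successively (adj E) (a # xs @ [c])"
    using assms(1) by (auto simp: joined_through_def)
  then show ?thesis
    using assms(2,3) successively_mono[of "adj E" "a # xs @ [c]" "adj E'"]
    unfolding joined_through_def by (intro exI[of _ xs]) (auto simp: adj_def)
qed

definition path_block :: "'v set \<Rightarrow> 'v \<Rightarrow> 'v \<Rightarrow> 'v set set" where
  "path_block S a c = {e. e \<inter> S \<noteq> {} \<and> e \<subseteq> insert a (insert c S)}"

lemma path_block_disjoint:
  "S \<inter> S' = {} \<Longrightarrow> {a, c} \<inter> S = {} \<Longrightarrow> path_block S a c \<inter> path_block S' a c = {}"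
  by (auto simp: path_block_def)

lemma determined_by_joined_through:
  fixes V :: "'a set"
  shows "determined_by (path_block S a c) (\<lambda>f. joined_through (graph V f) S a c)"
  unfolding determined_by_def joined_through_iff
proof (intro allI impI ex_cong1 conj_cong refl)
  fix f g :: "'a set \<Rightarrow> bool" and xs :: "'a list"
  assume eq: "\<forall>e\<in>path_block S a c. f e = g e" and xs: "xs \<noteq> []" "set xs \<subseteq> S"
  then have "f {u, v} = g {u, v}" if "u \<in> S \<or> v \<in> S" "u \<in> insert a (insert c S)" "v \<in> insert a (insert c S)" for u v
    using that by (auto simp: path_block_def)
  then have adj_eq: "adj (graph V f) u v = adj (graph V g) u v"
    if "u \<in> S \<or> v \<in> S" "u \<in> insert a (insert c S)" "v \<in> insert a (insert c S)" for u v
    using that by (auto simp: adj_graph)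
  have "hd xs \<in> S" "last xs \<in> S" using xs by auto
  then show "adj (graph V f) a (hd xs) = adj (graph V g) a (hd xs)"
    "adj (graph V f) (last xs) c = adj (graph V g) (last xs) c"
    using adj_eq by auto
  show "successively (adj (graph V f)) xs = successively (adj (graph V g)) xs"
    by (rule successively_cong) (use adj_eq xs in auto)
qed

lemma determined_by_comp2:
  "determined_by A F \<Longrightarrow> determined_by A G \<Longrightarrow> determined_by A (\<lambda>f. H (F f) (G f))"
  unfolding determined_by_def by (intro allI impI arg_cong2[where f = H]) blast+

lemma prob_conj_disjoint:
  assumes I: "finite I" and A: "determined_by S A" and B: "determined_by T B" and disj: "S \<inter> T = {}"
  shows "prob (coins I p) (\<lambda>f. A f \<and> B f) = prob (coins I p) A * prob (coins I p) B"
proof -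
  let ?A = "\<lambda>b. if b then A else B" and ?S = "\<lambda>b. if b then S else T"
  have "prob (coins I p) (\<lambda>f. \<forall>b\<in>{True, False}. ?A b f) = (\<Prod>b\<in>{True, False}. prob (coins I p) (?A b))"
    by (rule prob_all_disjoint[OF I, of _ ?S]) (use A B disj in \<open>auto simp: disjoint_family_on_def\<close>)
  moreover have "(\<forall>b\<in>{True, False}. ?A b f) \<longleftrightarrow> A f \<and> B f" for f by auto
  ultimately show ?thesis by (simp del: ball_simps)
qed

text \<open>The coins are revealed in three stages. First those between \<open>{a, c}\<close> and the reserve
\<open>U\<close> yield \<open>k\<close> common neighbours \<open>w\<close> of \<open>a\<close> and
\<open>c\<close>. Then those between \<open>{b, d} \<union> U\<close> and \<open>V\<^sub>1\<close> yield
for each \<open>w\<close> the exclusive common neighbours of \<open>b, w\<close> and of \<open>d, w\<close>,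
which rarely number less than \<open>m\<close>. These \<open>2 * k\<close> sets are disjoint, so the last
stage consists of independent attempts to join \<open>a\<close> to \<open>c\<close> through them; an attempt
for \<open>w\<close> succeeds for both of its sets with probability at least \<open>q\<^sup>2\<close>.\<close>

lemma prob_not_fills_square:
  fixes V :: "'a set"
  assumes V: "finite V" "{a, b, c, d} \<subseteq> V" "distinct [a, b, c, d]"
    and U: "U \<subseteq> V - {a, b, c, d}" and V1: "V\<^sub>1 \<subseteq> V - {a, b, c, d}" "U \<inter> V\<^sub>1 = {}"
    and k: "real k \<le> p\<^sup>2 * real (card U) / 2"
    and m: "real m \<le> (1 - \<delta>) * (p\<^sup>2 * (1 - p) ^ k) * real (card V\<^sub>1)"
    and q: "\<And>S. S \<subseteq> V\<^sub>1 \<Longrightarrow> m \<le> card S \<Longrightarrow> q \<le> prob (coins (pairs V) p) (\<lambda>f. joined_through (graph V f) S a c)"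
    and q0: "0 \<le> q" and p: "0 \<le> p" "p \<le> 1" and \<delta>: "0 \<le> \<delta>"
  shows "prob (coins (pairs V) p) (\<lambda>f. \<not> fills_square (graph V f) a b c d)
         \<le> exp (- (p\<^sup>2 * real (card U) / 8))
           + 2 * real k * exp (- (p\<^sup>2 * (1 - p) ^ k) * real (card V\<^sub>1) * \<delta>\<^sup>2 / 2) + exp (- (q\<^sup>2 * real k))"
proof -
  let ?P = "coins (pairs V) p" and ?t = "p\<^sup>2 * real (card U) / 2"
  let ?\<eta> = "exp (- (p\<^sup>2 * (1 - p) ^ k) * real (card V\<^sub>1) * \<delta>\<^sup>2 / 2)"
  define W where "W f = (SOME X. X \<subseteq> common_in f U a c \<and> card X = k)" for f :: "'a set \<Rightarrow> bool"
  define S where "S W = (\<lambda>f w. exclusive_nbrs f V\<^sub>1 W b d w)" for W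
  define T where "T W = (\<lambda>f w. exclusive_nbrs f V\<^sub>1 W d b w)" for W
  define Q\<^sub>2 where "Q\<^sub>2 f g \<longleftrightarrow> k \<le> card (common_in f U a c) \<and>
     ((\<exists>w\<in>W f. card (S (W f) g w) < m) \<or> (\<exists>w\<in>W f. card (T (W f) g w) < m))" for f g
  define Q\<^sub>3 where "Q\<^sub>3 f g \<longleftrightarrow> k \<le> card (common_in f U a c) \<and>
     (\<forall>w\<in>W f. m \<le> card (S (W f) f w) \<and> m \<le> card (T (W f) f w)) \<and>
     (\<forall>w\<in>W f. \<not> (joined_through (graph V g) (S (W f) f w) a c \<and> joined_through (graph V g) (T (W f) f w) a c))" for f g
  have fI: "finite (pairs V)" by (rule finite_pairs[OF V(1)])
  have fU: "finite U" using V U finite_subset by blast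
  have W: "W f \<subseteq> common_in f U a c" "card (W f) = k" if "k \<le> card (common_in f U a c)" for f
  proof -
    have "\<exists>X. X \<subseteq> common_in f U a c \<and> card X = k" by (meson obtain_subset_with_card_n that)
    then have "W f \<subseteq> common_in f U a c \<and> card (W f) = k"
      unfolding W_def by (rule someI_ex)
    then show "W f \<subseteq> common_in f U a c" "card (W f) = k" by auto
  qed
  have WU: "W f \<subseteq> U" "finite (W f)" if "k \<le> card (common_in f U a c)" for f
    using W[OF that] fU finite_subset[of "W f" U] by (auto simp: common_in_def)
  have "prob ?P (\<lambda>f. \<not> fills_square (graph V f) a b c d) \<le>
        prob ?P (\<lambda>f. (real (card (common_in f U a c)) \<le> ?t \<or> Q\<^sub>2 f f) \<or> Q\<^sub>3 f f)"
  proof (rule prob_mono, rule ccontr)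
    fix f assume f: "\<not> fills_square (graph V f) a b c d"
      and n: "\<not> ((real (card (common_in f U a c)) \<le> ?t \<or> Q\<^sub>2 f f) \<or> Q\<^sub>3 f f)"
    then have kc: "k \<le> card (common_in f U a c)" using k(1) by linarith
    with n obtain w where w: "w \<in> W f" "joined_through (graph V f) (S (W f) f w) a c"
        "joined_through (graph V f) (T (W f) f w) a c"
      by (auto simp: Q\<^sub>2_def Q\<^sub>3_def not_less)
    have wU: "w \<in> U" "f {w, a}" "f {w, c}" using W[OF kc] w(1) by (auto simp: common_in_def)
    have lab: "exclusive_nbrs f V\<^sub>1 X x y w \<subseteq> common_nbrs (graph V f) x w" if "x \<in> V" "x \<notin> V\<^sub>1" for X x y
    proof
      fix v assume v: "v \<in> exclusive_nbrs f V\<^sub>1 X x y w"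
      then have "v \<in> V\<^sub>1" "f {v, x}" "f {v, w}" by (simp_all add: exclusive_nbrs_def)
      moreover from this have "v \<in> V" "v \<noteq> x" "v \<noteq> w" "w \<in> V" using V1 U wU(1) that(2) by blast+
      ultimately show "v \<in> common_nbrs (graph V f) x w"
        using that(1) by (simp add: common_nbrs_def adj_graph)
    qed
    have "b \<in> V" "d \<in> V" "b \<notin> V\<^sub>1" "d \<notin> V\<^sub>1" using V(2) V1(1) by blast+
    then have "S (W f) f w \<subseteq> common_nbrs (graph V f) b w" "T (W f) f w \<subseteq> common_nbrs (graph V f) d w"
      unfolding S_def T_def using lab by blast+
    then have "joined_through (graph V f) (common_nbrs (graph V f) b w) a c"
      "joined_through (graph V f) (common_nbrs (graph V f) d w) a c"
      using joined_through_mono[OF w(2) order_refl] joined_through_mono[OF w(3) order_refl] by blast+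
    moreover have "w \<in> common_nbrs (graph V f) a c"
      using wU U V by (auto simp: common_nbrs_def adj_graph)
    ultimately have "fills_square (graph V f) a b c d"
      unfolding fills_square_def by blast
    then show False using f by simp
  qed
  also have "\<dots> \<le> prob ?P (\<lambda>f. real (card (common_in f U a c)) \<le> ?t) + prob ?P (\<lambda>f. Q\<^sub>2 f f) + prob ?P (\<lambda>f. Q\<^sub>3 f f)"
    by (intro order_trans[OF prob_disj_le] add_mono prob_disj_le order_refl)
  also have "prob ?P (\<lambda>f. real (card (common_in f U a c)) \<le> ?t) \<le> exp (- (p\<^sup>2 * real (card U) / 8))"
    using V U p by (intro few_common_neighbours) auto
  also have "prob ?P (\<lambda>f. Q\<^sub>2 f f) \<le> 2 * real k * ?\<eta>"
  proof (rule prob_two_stage_le[OF fI, where A = "{e. e \<inter> {a, c} \<noteq> {}}" and Q = Q\<^sub>2])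
    fix g
    show "determined_by {e. e \<inter> {a, c} \<noteq> {}} (\<lambda>f. Q\<^sub>2 f g)"
      unfolding determined_by_def
    proof (intro allI impI)
      fix f f' :: "'a set \<Rightarrow> bool" assume e: "\<forall>e\<in>{e. e \<inter> {a, c} \<noteq> {}}. f e = f' e"
      then have "common_in f U a c = common_in f' U a c" by (auto simp: common_in_def)
      then show "Q\<^sub>2 f g = Q\<^sub>2 f' g" by (simp add: Q\<^sub>2_def W_def)
    qed
  next
    fix f
    show "determined_by (- {e. e \<inter> {a, c} \<noteq> {}}) (Q\<^sub>2 f)"
      unfolding determined_by_def
    proof (intro allI impI)
      fix g g' :: "'a set \<Rightarrow> bool" assume e: "\<forall>e\<in>- {e. e \<inter> {a, c} \<noteq> {}}. g e = g' e"
      show "Q\<^sub>2 f g = Q\<^sub>2 f g'"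
      proof (cases "k \<le> card (common_in f U a c)")
        case True
        have eq: "g {v, z} = g' {v, z}" if "v \<in> V\<^sub>1" "z \<in> insert b (insert d (W f))" for v z
        proof -
          have "v \<in> V - {a, b, c, d}" using that(1) V1(1) by blast
          moreover have "z \<in> {b, d} \<or> z \<in> V - {a, b, c, d}" using that(2) U WU(1)[OF True] by blast
          ultimately have "{v, z} \<inter> {a, c} = {}" using V(3) by auto
          then show ?thesis using e by simp
        qed
        have "S (W f) g w = S (W f) g' w" "T (W f) g w = T (W f) g' w" if "w \<in> W f" for w
          unfolding S_def T_def using that by (auto intro!: exclusive_nbrs_cong eq)
        then show ?thesis by (simp add: Q\<^sub>2_def)
      qed (simp add: Q\<^sub>2_def)
    qed
  next
    fix f
    show "prob ?P (Q\<^sub>2 f) \<le> 2 * real k * ?\<eta>"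
    proof (cases "k \<le> card (common_in f U a c)")
      case False
      then have "{g. Q\<^sub>2 f g} = {}" by (auto simp: Q\<^sub>2_def)
      then show ?thesis by simp
    next
      case True
      have few: "prob ?P (\<lambda>g. card (exclusive_nbrs g V\<^sub>1 (W f) x y w) < m) \<le> ?\<eta>"
        if w: "w \<in> W f" and xy: "x = b \<and> y = d \<or> x = d \<and> y = b" for w x y
      proof -
        have "prob ?P (\<lambda>g. card (exclusive_nbrs g V\<^sub>1 (W f) x y w) < m) \<le>
              prob ?P (\<lambda>g. real (card (exclusive_nbrs g V\<^sub>1 (W f) x y w)) \<le> (1 - \<delta>) * (p\<^sup>2 * (1 - p) ^ k) * real (card V\<^sub>1))"
          by (rule prob_mono) (use m in linarith)
        also have "\<dots> \<le> ?\<eta>"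
        proof (rule few_exclusive_nbrs[OF V(1) _ _ _ _ _ w W(2)[OF True] p \<delta>])
          have bd: "b \<in> V" "d \<in> V" "V\<^sub>1 \<subseteq> V - {b, d} - W f" "W f \<subseteq> V - {b, d}"
            using V(2) V1 U WU(1)[OF True] by blast+
          have xy': "x \<in> {b, d}" "y \<in> {b, d}" "{x, y} = {b, d}" using xy by auto
          show "x \<in> V" "y \<in> V" using xy'(1,2) bd(1,2) by blast+
          show "x \<noteq> y" using xy V(3) by auto
          show "V\<^sub>1 \<subseteq> V - {x, y} - W f" "W f \<subseteq> V - {x, y}" unfolding xy'(3) using bd(3,4) .
        qed
        finally show ?thesis .
      qed
      have "prob ?P (Q\<^sub>2 f) \<le> prob ?P (\<lambda>g. (\<exists>w\<in>W f. card (S (W f) g w) < m) \<or> (\<exists>w\<in>W f. card (T (W f) g w) < m))"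
        by (rule prob_mono) (auto simp: Q\<^sub>2_def)
      also have "\<dots> \<le> prob ?P (\<lambda>g. \<exists>w\<in>W f. card (S (W f) g w) < m) + prob ?P (\<lambda>g. \<exists>w\<in>W f. card (T (W f) g w) < m)"
        by (rule prob_disj_le)
      also have "\<dots> \<le> (\<Sum>w\<in>W f. prob ?P (\<lambda>g. card (S (W f) g w) < m)) + (\<Sum>w\<in>W f. prob ?P (\<lambda>g. card (T (W f) g w) < m))"
        by (intro add_mono prob_Bex_le WU(2) True)
      also have "\<dots> \<le> (\<Sum>w\<in>W f. ?\<eta>) + (\<Sum>w\<in>W f. ?\<eta>)"
        unfolding S_def T_def by (intro add_mono sum_mono few) auto
      also have "\<dots> = 2 * real k * ?\<eta>" by (simp add: W(2)[OF True])
      finally show ?thesis .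
    qed
  qed
  also have "prob ?P (\<lambda>f. Q\<^sub>3 f f) \<le> exp (- (q\<^sup>2 * real k))"
  proof (rule prob_two_stage_le[OF fI, where A = "{e. e \<inter> insert b (insert d U) \<noteq> {}}" and Q = Q\<^sub>3])
    fix g
    show "determined_by {e. e \<inter> insert b (insert d U) \<noteq> {}} (\<lambda>f. Q\<^sub>3 f g)"
      unfolding determined_by_def
    proof (intro allI impI)
      fix f f' :: "'a set \<Rightarrow> bool" assume "\<forall>e\<in>{e. e \<inter> insert b (insert d U) \<noteq> {}}. f e = f' e"
      then have e: "f e = f' e" if "e \<inter> insert b (insert d U) \<noteq> {}" for e using that by blast
      have "f {w, z} = f' {w, z}" if "w \<in> U" for w z by (rule e) (use that in blast)
      then have sn: "common_in f U a c = common_in f' U a c" unfolding common_in_def by (intro Collect_cong) blast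
      then have Weq: "W f = W f'" by (simp add: W_def)
      show "Q\<^sub>3 f g = Q\<^sub>3 f' g"
      proof (cases "k \<le> card (common_in f U a c)")
        case True
        have eq: "f {v, z} = f' {v, z}" if "z \<in> insert b (insert d (W f))" for v z
          by (rule e) (use that WU(1)[OF True] in blast)
        have "S (W f) f w = S (W f) f' w" "T (W f) f w = T (W f) f' w" if "w \<in> W f" for w
          unfolding S_def T_def using that by (auto intro!: exclusive_nbrs_cong eq)
        then show ?thesis using sn Weq by (simp add: Q\<^sub>3_def)
      qed (use sn in \<open>simp add: Q\<^sub>3_def\<close>)
    qed
  next
    fix f
    show "determined_by (- {e. e \<inter> insert b (insert d U) \<noteq> {}}) (Q\<^sub>3 f)"
      unfolding determined_by_def
    proof (intro allI impI)
      fix g g' :: "'a set \<Rightarrow> bool" assume "\<forall>e\<in>- {e. e \<inter> insert b (insert d U) \<noteq> {}}. g e = g' e"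
      then have e: "g e = g' e" if "e \<inter> insert b (insert d U) = {}" for e using that by blast
      have "joined_through (graph V g) X a c = joined_through (graph V g') X a c" if "X \<subseteq> V\<^sub>1" for X
      proof (rule determined_byD[OF determined_by_joined_through])
        fix e' assume "e' \<in> path_block X a c"
        then have "e' \<subseteq> insert a (insert c V\<^sub>1)" using that by (auto simp: path_block_def)
        moreover have "insert a (insert c V\<^sub>1) \<inter> insert b (insert d U) = {}"
          using V(3) V1 U by auto
        ultimately have "e' \<inter> insert b (insert d U) = {}" by blast
        then show "g e' = g' e'" by (rule e)
      qed
      moreover have "S (W f) f w \<subseteq> V\<^sub>1" "T (W f) f w \<subseteq> V\<^sub>1" for w
        by (auto simp: S_def T_def exclusive_nbrs_def)
      ultimately show "Q\<^sub>3 f g = Q\<^sub>3 f g'" by (simp add: Q\<^sub>3_def)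
    qed
  next
    fix f
    show "prob ?P (Q\<^sub>3 f) \<le> exp (- (q\<^sup>2 * real k))"
    proof (cases "k \<le> card (common_in f U a c) \<and> (\<forall>w\<in>W f. m \<le> card (S (W f) f w) \<and> m \<le> card (T (W f) f w))")
      case False
      then have "{g. Q\<^sub>3 f g} = {}" unfolding Q\<^sub>3_def by blast
      then show ?thesis by simp
    next
      case True
      let ?S = "S (W f) f" and ?T = "T (W f) f"
      let ?J = "\<lambda>X g. joined_through (graph V g) X a c"
      let ?B = "\<lambda>w. path_block (?S w) a c \<union> path_block (?T w) a c"
      have V1': "?S w \<subseteq> V\<^sub>1" "?T w \<subseteq> V\<^sub>1" for w by (auto simp: S_def T_def exclusive_nbrs_def)
      have ac: "{a, c} \<inter> ?S w = {}" "{a, c} \<inter> ?T w = {}" for w using V1' V1 by blast+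
      have ST: "?S w \<inter> ?T w' = {}" for w w' by (auto simp: S_def T_def exclusive_nbrs_def)
      have SS: "?S w \<inter> ?S w' = {}" "?T w \<inter> ?T w' = {}" if "w \<in> W f" "w' \<in> W f" "w \<noteq> w'" for w w'
        using that by (auto simp: S_def T_def exclusive_nbrs_def)
      have dis: "disjoint_family_on ?B (W f)"
        unfolding disjoint_family_on_def
      proof (intro ballI impI)
        fix w w' assume w: "w \<in> W f" "w' \<in> W f" "w \<noteq> w'"
        show "?B w \<inter> ?B w' = {}"
          using path_block_disjoint[OF SS(1)[OF w] ac(1)] path_block_disjoint[OF SS(2)[OF w] ac(2)]
            path_block_disjoint[OF ST[of w w'] ac(1)] path_block_disjoint[OF ST[of w' w] ac(1)] by blast
      qed
      have "prob ?P (Q\<^sub>3 f) \<le> prob ?P (\<lambda>g. \<forall>w\<in>W f. \<not> (?J (?S w) g \<and> ?J (?T w) g))"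
        by (rule prob_mono) (simp add: Q\<^sub>3_def)
      also have "\<dots> = (\<Prod>w\<in>W f. prob ?P (\<lambda>g. \<not> (?J (?S w) g \<and> ?J (?T w) g)))"
      proof (rule prob_all_disjoint[OF fI WU(2) _ dis])
        fix w
        have "determined_by (?B w) (?J (?S w))" "determined_by (?B w) (?J (?T w))"
          by (rule determined_by_mono[OF determined_by_joined_through], simp)+
        then show "determined_by (?B w) (\<lambda>g. \<not> (?J (?S w) g \<and> ?J (?T w) g))"
          by (rule determined_by_comp2)
      qed (use True in blast)
      also have "\<dots> \<le> (\<Prod>w\<in>W f. exp (- (q\<^sup>2)))"
      proof (intro prod_mono conjI)
        fix w assume w: "w \<in> W f"
        have "prob ?P (\<lambda>g. ?J (?S w) g \<and> ?J (?T w) g) = prob ?P (?J (?S w)) * prob ?P (?J (?T w))"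
          by (rule prob_conj_disjoint[OF fI determined_by_joined_through determined_by_joined_through
                path_block_disjoint[OF ST ac(1)]])
        moreover have "q * q \<le> prob ?P (?J (?S w)) * prob ?P (?J (?T w))"
          using True w q0 by (intro mult_mono q V1') auto
        ultimately have "prob ?P (\<lambda>g. \<not> (?J (?S w) g \<and> ?J (?T w) g)) \<le> 1 - q\<^sup>2"
          by (subst prob_Not) (simp add: power2_eq_square)
        also have "\<dots> \<le> exp (- (q\<^sup>2))" using exp_ge_add_one_self[of "- (q\<^sup>2)"] by simp
        finally show "prob ?P (\<lambda>g. \<not> (?J (?S w) g \<and> ?J (?T w) g)) \<le> exp (- (q\<^sup>2))" .
      qed simp
      also have "\<dots> = exp (- (q\<^sup>2)) ^ k" using W(2) True by simp
      also have "\<dots> = exp (- (q\<^sup>2 * real k))" by (simp add: exp_of_nat_mult[symmetric] mult.commute)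
      finally show ?thesis .
    qed
  qed
  finally show ?thesis by simp
qed

section \<open>The union bound\<close>

lemma fills_square_mono:
  assumes "fills_square E a b c d" "E \<subseteq> E'"
  shows "fills_square E' a b c d"
proof -
  have sub: "common_nbrs E x y \<subseteq> common_nbrs E' x y" for x y
    using assms(2) by (auto simp: common_nbrs_def adj_def)
  obtain w where w: "w \<in> common_nbrs E a c" "joined_through E (common_nbrs E b w) a c"
    "joined_through E (common_nbrs E d w) a c"
    using assms(1) by (auto simp: fills_square_def)
  have "w \<in> common_nbrs E' a c" using w(1) sub by blast
  moreover have "joined_through E' (common_nbrs E' b w) a c"
    by (rule joined_through_mono[OF w(2) assms(2) sub])
  moreover have "joined_through E' (common_nbrs E' d w) a c"
    by (rule joined_through_mono[OF w(3) assms(2) sub])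
  ultimately show ?thesis unfolding fills_square_def by blast
qed

lemma splits_pentagon_mono:
  assumes "splits_pentagon E r u v" "E \<subseteq> E'"
  shows "splits_pentagon E' r u v"
proof -
  have sub: "common_nbrs E x y \<subseteq> common_nbrs E' x y" for x y
    using assms(2) by (auto simp: common_nbrs_def adj_def)
  obtain w w' where w: "w \<in> common_nbrs E r u" "w \<noteq> v" "w' \<in> common_nbrs E r v" "w' \<noteq> u" "adj E w w'"
    using assms(1) by (auto simp: splits_pentagon_def)
  have "w \<in> common_nbrs E' r u - {v}" using w(1,2) sub by blast
  moreover have "w' \<in> common_nbrs E' r v - {u}" using w(3,4) sub by blast
  moreover have "adj E' w w'" using w(5) assms(2) by (auto simp: adj_def)
  ultimately show ?thesis unfolding splits_pentagon_def by blast
qed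

lemma prob_Gnp: "measure_pmf.prob (Gnp n p) {E. P E} = prob (coins (pairs {1..n}) p) (\<lambda>f. P (graph {1..n} f))"
  by (simp add: Gnp_def vertex_pairs_def pairs_def vimage_def)

lemma prob_joined_through_large:
  fixes V :: "'v set"
  assumes V: "finite V" "insert a (insert c S) \<subseteq> V" and S: "a \<notin> S" "c \<notin> S" "a \<noteq> c"
    and m: "m \<le> card S"
    and p: "0 < p" "p \<le> 1" and kap: "\<kappa> = real m * p"
    and K: "1 < \<kappa>" "1 \<le> K" "2 * \<kappa> \<le> K * (\<kappa> - 1)" and l: "1 \<le> l" "4 * K * (real l)\<^sup>2 * p \<le> 1"
    and big: "1 \<le> p * \<kappa> ^ l" and ml: "2 * l\<^sup>2 \<le> m"
  shows "1 / (24 * K * (real l)\<^sup>2) \<le> prob (coins (pairs V) p) (\<lambda>f. joined_through (graph V f) S a c)"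
proof -
  obtain S' where S': "S' \<subseteq> S" "card S' = m" "finite S'"
    by (rule obtain_subset_with_card_n[OF m])
  have "1 / (24 * K * (real l)\<^sup>2) \<le> prob (coins (pairs V) p) (\<lambda>f. joined_through (graph V f) S' a c)"
    by (rule prob_joined_through[OF finite_pairs[OF V(1)] _ _ _ _ _ p _ K l big])
       (use S S' V kap ml in \<open>auto simp: doubleton_in_pairs\<close>)
  also have "\<dots> \<le> prob (coins (pairs V) p) (\<lambda>f. joined_through (graph V f) S a c)"
    by (rule prob_mono, erule joined_through_mono) (use S' in auto)
  finally show ?thesis .
qed

text \<open>All estimates are made for the smaller probability \<open>p\<close>. They carry over to \<open>p'\<close>
because for each single tuple the desired event is increasing.\<close>

lemma prob_not_simply_connected_le:
  fixes n k u m l :: nat and p p' \<delta> K :: real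
  assumes p: "0 < p" "p \<le> p'" "p' \<le> 1" and u: "2 * u + 5 \<le> n"
    and k: "real k \<le> p\<^sup>2 * real u / 2"
    and m: "real m \<le> (1 - \<delta>) * (p\<^sup>2 * (1 - p) ^ k) * real (n - 4 - u)" and \<delta>: "0 \<le> \<delta>"
    and K: "1 < real m * p" "1 \<le> K" "2 * (real m * p) \<le> K * (real m * p - 1)"
    and l: "1 \<le> l" "4 * K * (real l)\<^sup>2 * p \<le> 1" "1 \<le> p * (real m * p) ^ l" "2 * l\<^sup>2 \<le> m"
  defines "q \<equiv> 1 / (24 * K * (real l)\<^sup>2)"
  shows "1 - measure_pmf.prob (Gnp n p') {E. simply_connected_complex (clique_complex_2 {1..n} E)} \<le>
     real n ^ 4 * (exp (- (p\<^sup>2 * real u / 8))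
           + 2 * real k * exp (- (p\<^sup>2 * (1 - p) ^ k) * real (n - 4 - u) * \<delta>\<^sup>2 / 2) + exp (- (q\<^sup>2 * real k)))
     + real n ^ 3 * (2 * exp (- (p\<^sup>2 * real u / 8)) + exp (- (p * (real k)\<^sup>2)))" (is "_ \<le> real n ^ 4 * ?bs + real n ^ 3 * ?bp")
proof -
  define V where "V = {1..n}"
  have V: "finite V" "card V = n" by (auto simp: V_def)
  let ?P = "coins (pairs V) p" and ?P' = "coins (pairs V) p'"
  let ?J4 = "{(a, b, c, d). {a, b, c, d} \<subseteq> V \<and> distinct [a, b, c, d]}"
  let ?J3 = "{(r, u, v). {r, u, v} \<subseteq> V \<and> distinct [r, u, v]}"
  let ?S = "\<lambda>(a, b, c, d) f. \<not> fills_square (graph V f) a b c d"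
  let ?R = "\<lambda>(r, u, v) f. \<not> splits_pentagon (graph V f) r u v"
  have p1: "0 \<le> p" "p \<le> 1" using p by auto
  have dec: "prob ?P' (\<lambda>f. \<not> G (graph V f)) \<le> prob ?P (\<lambda>f. \<not> G (graph V f))"
    if "\<And>E E'. G E \<Longrightarrow> E \<subseteq> E' \<Longrightarrow> G E'" for G
  proof -
    have "prob ?P (\<lambda>f. G (graph V f)) \<le> prob ?P' (\<lambda>f. G (graph V f))"
      by (rule prob_coins_mono[OF finite_pairs[OF V(1)] _ p1(1) p(2,3)]) (erule that, auto)
    then show ?thesis by (simp add: prob_Not)
  qed
  have square: "prob ?P' (?S t) \<le> ?bs" if "t \<in> ?J4" for t
  proof -
    obtain a b c d where t: "t = (a, b, c, d)" "{a, b, c, d} \<subseteq> V" "distinct [a, b, c, d]"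
      using \<open>t \<in> ?J4\<close> by blast
    have c4: "card (V - {a, b, c, d}) = n - 4"
      using t V by (simp add: card_Diff_subset)
    then have "u \<le> card (V - {a, b, c, d})" using u by simp
    then obtain U where U: "U \<subseteq> V - {a, b, c, d}" "card U = u" "finite U"
      by (rule obtain_subset_with_card_n)
    define V1 where "V1 = V - {a, b, c, d} - U"
    have cV1: "card V1 = n - 4 - u" unfolding V1_def using U c4 by (simp add: card_Diff_subset)
    have "prob ?P' (?S t) \<le> prob ?P (?S t)"
      unfolding t(1) prod.case by (rule dec) (rule fills_square_mono)
    also have "\<dots> \<le> exp (- (p\<^sup>2 * real (card U) / 8))
           + 2 * real k * exp (- (p\<^sup>2 * (1 - p) ^ k) * real (card V1) * \<delta>\<^sup>2 / 2) + exp (- (q\<^sup>2 * real k))"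
      unfolding t(1) prod.case
    proof (rule prob_not_fills_square[OF V(1) t(2,3) U(1)])
      show "q \<le> prob ?P (\<lambda>f. joined_through (graph V f) S a c)" if S: "S \<subseteq> V1" "m \<le> card S" for S
        unfolding q_def
      proof (rule prob_joined_through_large[OF V(1) _ _ _ _ S(2) p(1) p1(2) refl K l])
        have "S \<subseteq> V - {a, b, c, d}" using S by (auto simp: V1_def)
        then show "insert a (insert c S) \<subseteq> V" "a \<notin> S" "c \<notin> S" "a \<noteq> c" using t(2,3) by auto
      qed
      show "V1 \<subseteq> V - {a, b, c, d}" "U \<inter> V1 = {}" unfolding V1_def by blast+
      show "real k \<le> p\<^sup>2 * real (card U) / 2" using k U(2) by simp
      show "real m \<le> (1 - \<delta>) * (p\<^sup>2 * (1 - p) ^ k) * real (card V1)" unfolding cV1 by (rule m)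
      show "0 \<le> q" using K(2) by (simp add: q_def)
    qed (fact p1 \<delta>)+
    finally show ?thesis by (simp add: U cV1)
  qed
  have pentagon: "prob ?P' (?R t) \<le> ?bp" if "t \<in> ?J3" for t
  proof -
    obtain r x y where t: "t = (r, x, y)" "{r, x, y} \<subseteq> V" "distinct [r, x, y]"
      using \<open>t \<in> ?J3\<close> by blast
    have "card (V - {r, x, y}) = n - 3"
      using t V by (simp add: card_Diff_subset)
    then have "2 * u \<le> card (V - {r, x, y})" using u by simp
    then obtain W where W: "W \<subseteq> V - {r, x, y}" "card W = 2 * u" "finite W"
      by (rule obtain_subset_with_card_n)
    have "u \<le> card W" using W(2) by simp
    then obtain U where U: "U \<subseteq> W" "card U = u" "finite U" by (rule obtain_subset_with_card_n)
    have "prob ?P' (?R t) \<le> prob ?P (?R t)"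
      unfolding t(1) prod.case by (rule dec) (rule splits_pentagon_mono)
    also have "\<dots> \<le> 2 * exp (- (p\<^sup>2 * real (card U) / 8)) + exp (- (p * (real k)\<^sup>2))"
      unfolding t(1) prod.case
    proof (rule prob_not_splits_pentagon[OF V(1) t(2,3), of U "W - U"])
      show "U \<subseteq> V - {r, x, y}" "W - U \<subseteq> V - {r, x, y}" "U \<inter> (W - U) = {}" using U(1) W(1) by blast+
      show "real k \<le> p\<^sup>2 * real (card U) / 2" using k U(2) by simp
      show "card (W - U) = card U" using card_Diff_subset[OF U(3,1)] U(2) W(2) by simp
    qed (fact p1)+
    finally show ?thesis by (simp add: U)
  qed
  have J4: "finite ?J4" "card ?J4 \<le> n ^ 4"
  proof -
    have sub: "?J4 \<subseteq> V \<times> V \<times> V \<times> V" by auto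
    show "finite ?J4" by (rule finite_subset[OF sub]) (use V in auto)
    show "card ?J4 \<le> n ^ 4"
      using card_mono[OF _ sub] V by (simp add: card_cartesian_product power4_eq_xxxx mult.assoc)
  qed
  have J3: "finite ?J3" "card ?J3 \<le> n ^ 3"
  proof -
    have sub: "?J3 \<subseteq> V \<times> V \<times> V" by auto
    show "finite ?J3" by (rule finite_subset[OF sub]) (use V in auto)
    show "card ?J3 \<le> n ^ 3"
      using card_mono[OF _ sub] V by (simp add: card_cartesian_product power3_eq_cube mult.assoc)
  qed
  have "1 - measure_pmf.prob (Gnp n p') {E. simply_connected_complex (clique_complex_2 {1..n} E)} =
        prob ?P' (\<lambda>f. \<not> simply_connected_complex (clique_complex_2 V (graph V f)))"
    unfolding prob_Gnp V_def[symmetric] by (rule prob_Not[symmetric])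
  also have "\<dots> \<le> prob ?P' (\<lambda>f. (\<exists>t\<in>?J4. ?S t f) \<or> (\<exists>t\<in>?J3. ?R t f))"
  proof (rule prob_mono, rule ccontr)
    fix f assume f: "\<not> simply_connected_complex (clique_complex_2 V (graph V f))"
      and "\<not> ((\<exists>t\<in>?J4. ?S t f) \<or> (\<exists>t\<in>?J3. ?R t f))"
    then have good: "\<not> (\<exists>t\<in>?J4. ?S t f)" "\<not> (\<exists>t\<in>?J3. ?R t f)"
      by (simp_all only: de_Morgan_disj simp_thms)
    have "simply_connected_complex (clique_complex_2 V (graph V f))"
    proof (rule clique_complex_simply_connected[OF V(1)])
      show "3 \<le> card V" using V u by simp
      show "u \<in> V \<and> v \<in> V" if "adj (graph V f) u v" for u v using that by (simp add: adj_graph)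
      show "fills_square (graph V f) a b c d" if "{a, b, c, d} \<subseteq> V" "distinct [a, b, c, d]" for a b c d
      proof (rule ccontr)
        assume "\<not> fills_square (graph V f) a b c d"
        then have "?S (a, b, c, d) f" "(a, b, c, d) \<in> ?J4" using that by simp_all
        then have "\<exists>t\<in>?J4. ?S t f" by (rule bexI)
        with good(1) show False by (rule notE)
      qed
      show "splits_pentagon (graph V f) r u v" if "{r, u, v} \<subseteq> V" "distinct [r, u, v]" for r u v
      proof (rule ccontr)
        assume "\<not> splits_pentagon (graph V f) r u v"
        then have "?R (r, u, v) f" "(r, u, v) \<in> ?J3" using that by simp_all
        then have "\<exists>t\<in>?J3. ?R t f" by (rule bexI)
        with good(2) show False by (rule notE)
      qed
    qed
    then show False using f by blast
  qed
  also have "\<dots> \<le> prob ?P' (\<lambda>f. \<exists>t\<in>?J4. ?S t f) + prob ?P' (\<lambda>f. \<exists>t\<in>?J3. ?R t f)"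
    by (rule prob_disj_le)
  also have "\<dots> \<le> (\<Sum>t\<in>?J4. prob ?P' (?S t)) + (\<Sum>t\<in>?J3. prob ?P' (?R t))"
    by (intro add_mono prob_Bex_le J3 J4)
  also have "\<dots> \<le> (\<Sum>t\<in>?J4. ?bs) + (\<Sum>t\<in>?J3. ?bp)"
    by (intro add_mono sum_mono square pentagon)
  also have "\<dots> = real (card ?J4) * ?bs + real (card ?J3) * ?bp" by simp
  also have "\<dots> \<le> real (n ^ 4) * ?bs + real (n ^ 3) * ?bp"
    using J3(2) J4(2) by (intro add_mono mult_right_mono of_nat_mono) simp_all
  finally show ?thesis by simp
qed

section \<open>Asymptotics\<close>

text \<open>The requirements on the parameters for \<open>x = n\<close> large, where
\<open>p = c * x powr (-1/3)\<close>, the reserve has \<open>x powr (19/20)\<close> vertices,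
\<open>x powr (1/4)\<close> candidates are used, \<open>\<delta> = x powr (-1/10)\<close>, and
\<open>L x\<close> bounds the length of the paths. The exponents satisfy \<open>1/4 < 19/20 - 2/3\<close>
(enough common neighbours in the reserve), \<open>1/4 < 1/3\<close> (exclusivity is cheap) and
\<open>1/4 > 1/6\<close> (two adjacent vertices for a pentagon). In the fourth statement the quotient of the
two sides tends to \<open>c\<^sup>2 > 1\<close>; this is where the constant in the threshold is used.\<close>

lemma parameters_eventually:
  fixes c K :: real
  assumes c: "c > 1" and K: "K > 0"
  defines "L \<equiv> (\<lambda>x. ln x / ln c + 1)"
  shows "\<forall>\<^sub>F x in at_top. c * x powr (-1/3) \<le> 1"
    and "\<forall>\<^sub>F x in at_top. 2 * x powr (19/20) + 5 \<le> (x::real)"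
    and "\<forall>\<^sub>F x in at_top. x powr (1/4) \<le> x powr (-2/3) * (x powr (19/20) - 1) / (2::real)"
    and "\<forall>\<^sub>F x in at_top. x powr (1/3) + 1 \<le>
           (1 - x powr (-1/10)) * (c\<^sup>2 * x powr (-2/3) * (1 - x powr (1/4) * (c * x powr (-1/3)))) * (x - 4 - x powr (19/20))"
    and "\<forall>\<^sub>F x in at_top. 4 * K * (L x)\<^sup>2 * (c * x powr (-1/3)) \<le> 1"
    and "\<forall>\<^sub>F x in at_top. 2 * (L x)\<^sup>2 \<le> x powr (1/3)"
proof -
  define g where "g = ln c"
  have g: "g > 0" using c by (simp add: g_def)
  have c2: "c\<^sup>2 > 1" using c by (simp add: power2_eq_square less_1_mult)
  have c0: "c > 0" using c by simp
  note * = g c c2 c0 K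
  show "\<forall>\<^sub>F x in at_top. c * x powr (-1/3) \<le> 1" using * by real_asymp
  show "\<forall>\<^sub>F x in at_top. 2 * x powr (19/20) + 5 \<le> (x::real)" by real_asymp
  show "\<forall>\<^sub>F x in at_top. x powr (1/4) \<le> x powr (-2/3) * (x powr (19/20) - 1) / (2::real)" by real_asymp
  have "((\<lambda>x. ((1 - x powr (-1/10)) * (c\<^sup>2 * x powr (-2/3) * (1 - x powr (1/4) * (c * x powr (-1/3)))) * (x - 4 - x powr (19/20)))
      / (x powr (1/3) + 1)) \<longlongrightarrow> c\<^sup>2) at_top" using * by real_asymp
  then have "\<forall>\<^sub>F x in at_top. ((1 - x powr (-1/10)) * (c\<^sup>2 * x powr (-2/3) * (1 - x powr (1/4) * (c * x powr (-1/3)))) * (x - 4 - x powr (19/20)))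
      / (x powr (1/3) + 1) > 1" using c2 by (rule order_tendstoD)
  then show "\<forall>\<^sub>F x in at_top. x powr (1/3) + 1 \<le>
           (1 - x powr (-1/10)) * (c\<^sup>2 * x powr (-2/3) * (1 - x powr (1/4) * (c * x powr (-1/3)))) * (x - 4 - x powr (19/20))"
  proof eventually_elim
    case (elim x)
    have "0 < x powr (1/3) + 1" using powr_ge_zero[of x "1/3"] by linarith
    then show ?case using elim by (simp add: less_divide_eq)
  qed
  show "\<forall>\<^sub>F x in at_top. 4 * K * (L x)\<^sup>2 * (c * x powr (-1/3)) \<le> 1"
    unfolding L_def g_def[symmetric] using * by real_asymp
  show "\<forall>\<^sub>F x in at_top. 2 * (L x)\<^sup>2 \<le> x powr (1/3)"
    unfolding L_def g_def[symmetric] using * by real_asymp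
qed

lemma union_bound_vanishes:
  fixes g K :: real
  assumes "g > 0" "K > 0"
  shows "((\<lambda>x. x ^ 4 * (exp (- (x powr (-2/3) * (x powr (19/20) - 1) / 8)) + 2 * x powr (1/4) * exp (- (x powr (2/15) / 2))
              + exp (- ((x powr (1/4) - 1) / (24 * K * (ln x / g + 1)\<^sup>2)\<^sup>2)))
           + x ^ 3 * (2 * exp (- (x powr (-2/3) * (x powr (19/20) - 1) / 8)) + exp (- (x powr (-1/3) * (x powr (1/4) - 1)\<^sup>2)))) \<longlongrightarrow> 0) at_top"
  using assms by real_asymp

theorem corollary1p6:
  fixes \<epsilon> :: real and p :: "nat \<Rightarrow> real"
  assumes "\<epsilon> > 0"
    and "\<And>n. p n \<in> {0..1}"
    and "\<forall>\<^sub>F n in sequentially. p n \<ge> (1 + \<epsilon>) * real n powr (-1/3)"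
  shows "(\<lambda>n. measure_pmf.prob (Gnp n (p n))
                {E. simply_connected_complex (clique_complex_2 {1..n} E)}) \<longlonglongrightarrow> 1"
proof -
  define c where "c = 1 + \<epsilon>"
  define K where "K = 2 * c / (c - 1)"
  have c: "c > 1" using assms(1) by (simp add: c_def)
  have K: "K \<ge> 1" using c by (simp add: K_def field_simps)
  let ?L = "\<lambda>x. ln x / ln c + 1"
  let ?P = "\<lambda>n. measure_pmf.prob (Gnp n (p n)) {E. simply_connected_complex (clique_complex_2 {1..n} E)}"
  let ?G = "\<lambda>x. x ^ 4 * (exp (- (x powr (-2/3) * (x powr (19/20) - 1) / 8)) + 2 * x powr (1/4) * exp (- (x powr (2/15) / 2))
              + exp (- ((x powr (1/4) - 1) / (24 * K * (?L x)\<^sup>2)\<^sup>2)))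
           + x ^ 3 * (2 * exp (- (x powr (-2/3) * (x powr (19/20) - 1) / 8)) + exp (- (x powr (-1/3) * (x powr (1/4) - 1)\<^sup>2)))"
  have lnc: "ln c > 0" using c by simp
  have K0: "K > 0" using K by simp
  note params = parameters_eventually[OF c K0, THEN eventually_compose_filterlim, OF filterlim_real_sequentially]
  have upper: "\<forall>\<^sub>F n in sequentially. 1 - ?P n \<le> ?G (real n)"
    using params assms(3) eventually_ge_at_top[of 2]
  proof eventually_elim
    case (elim n)
    define x where "x = real n"
    define q where "q = c * x powr (-1/3)"
    define u where "u = nat \<lfloor>x powr (19/20)\<rfloor>"
    define k where "k = nat \<lfloor>x powr (1/4)\<rfloor>"
    define m where "m = nat \<lceil>x powr (1/3)\<rceil>"
    define l where "l = nat \<lceil>ln x / ln c\<rceil>"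
    define \<delta> where "\<delta> = x powr (-1/10)"
    have x: "x \<ge> 2" using elim(8) by (simp add: x_def)
    have e: "q \<le> 1" "2 * x powr (19/20) + 5 \<le> x" "x powr (1/4) \<le> x powr (-2/3) * (x powr (19/20) - 1) / 2"
      "x powr (1/3) + 1 \<le> (1 - \<delta>) * (c\<^sup>2 * x powr (-2/3) * (1 - x powr (1/4) * q)) * (x - 4 - x powr (19/20))"
      "4 * K * (?L x)\<^sup>2 * q \<le> 1" "2 * (?L x)\<^sup>2 \<le> x powr (1/3)" "q \<le> p n"
      using elim by (simp_all add: x_def q_def \<delta>_def c_def)
    have floor: "real (nat \<lfloor>y\<rfloor>) \<le> y \<and> y - 1 \<le> real (nat \<lfloor>y\<rfloor>)"
      and ceil: "y \<le> real (nat \<lceil>y\<rceil>) \<and> real (nat \<lceil>y\<rceil>) \<le> y + 1" if "0 \<le> y" for y :: real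
    proof -
      have "real (nat \<lfloor>y\<rfloor>) = of_int \<lfloor>y\<rfloor>" "real (nat \<lceil>y\<rceil>) = of_int \<lceil>y\<rceil>" using that by simp_all
      then show "real (nat \<lfloor>y\<rfloor>) \<le> y \<and> y - 1 \<le> real (nat \<lfloor>y\<rfloor>)"
        "y \<le> real (nat \<lceil>y\<rceil>) \<and> real (nat \<lceil>y\<rceil>) \<le> y + 1" by linarith+
    qed
    have u: "real u \<le> x powr (19/20)" "x powr (19/20) - 1 \<le> real u" unfolding u_def using floor by simp_all
    have k: "real k \<le> x powr (1/4)" "x powr (1/4) - 1 \<le> real k" unfolding k_def using floor by simp_all
    \<comment> \<open>With \<open>m\<close> vertices, the average degree \<open>m * q\<close> in each attempt is at least \<open>c\<close>.\<close>
    have m: "x powr (1/3) \<le> real m" "real m \<le> x powr (1/3) + 1" unfolding m_def using ceil by simp_all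
    have lx: "ln x / ln c > 0" using x lnc by simp
    have l: "ln x / ln c \<le> real l" "real l \<le> ?L x" unfolding l_def using ceil[of "ln x / ln c"] lx by auto
    have l1: "1 \<le> l" using l(1) lx by linarith
    have q0: "0 < q" using c x by (simp add: q_def)
    have q2: "q\<^sup>2 = c\<^sup>2 * x powr (-2/3)"
      using x by (simp add: q_def power_mult_distrib powr_power)
    have c2: "1 \<le> c\<^sup>2" using c by simp
    have q2ge: "x powr (-2/3) \<le> q\<^sup>2" unfolding q2 using mult_right_mono[OF c2, of "x powr (-2/3)"] by simp
    have qge: "x powr (-1/3) \<le> q" unfolding q_def using c mult_right_mono[of 1 c "x powr (-1/3)"] by simp
    have qu: "x powr (-2/3) * (x powr (19/20) - 1) \<le> q\<^sup>2 * real u"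
    proof -
      have "x powr (-2/3) * (x powr (19/20) - 1) \<le> x powr (-2/3) * real u" using u by (intro mult_left_mono) auto
      also have "\<dots> \<le> q\<^sup>2 * real u" using q2ge by (intro mult_right_mono) auto
      finally show ?thesis .
    qed
    have un: "2 * u + 5 \<le> n" using u(1) e(2) by (simp add: x_def)
    have \<delta>01: "0 \<le> \<delta>" "\<delta> \<le> 1" using x powr_mono[of "-1/10" 0 x] by (auto simp: \<delta>_def)
    define s where "s = q\<^sup>2 * (1 - q) ^ k * real (n - 4 - u)"
    have s: "x powr (1/3) + 1 \<le> (1 - \<delta>) * s"
    proof -
      have nn: "real (n - 4 - u) = x - 4 - real u" using un by (simp add: x_def of_nat_diff)
      have bern: "1 - x powr (1/4) * q \<le> (1 - q) ^ k"
      proof -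
        have "1 - x powr (1/4) * q \<le> 1 - real k * q" using k(1) q0 by (simp add: mult_right_mono)
        also have "\<dots> \<le> (1 - q) ^ k" using Bernoulli_inequality[of "- q" k] e(1) by simp
        finally show ?thesis .
      qed
      have room: "0 \<le> x - 4 - x powr (19/20)" using e(2) powr_ge_zero[of x "19/20"] by linarith
      have "(1 - \<delta>) * (c\<^sup>2 * x powr (-2/3) * (1 - x powr (1/4) * q)) * (x - 4 - x powr (19/20)) \<le>
            (1 - \<delta>) * (c\<^sup>2 * x powr (-2/3) * (1 - q) ^ k) * (x - 4 - x powr (19/20))"
        using \<delta>01 room bern by (intro mult_right_mono mult_left_mono) auto
      also have "\<dots> \<le> (1 - \<delta>) * (c\<^sup>2 * x powr (-2/3) * (1 - q) ^ k) * (x - 4 - real u)"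
        using \<delta>01 e(1) u(1) by (intro mult_left_mono) auto
      also have "\<dots> = (1 - \<delta>) * s" by (simp only: s_def q2 nn mult.assoc)
      finally show ?thesis using e(4) by linarith
    qed
    have s0: "0 \<le> s" using e(1) by (simp add: s_def)
    have sge: "x powr (1/3) \<le> s"
    proof -
      have "(1 - \<delta>) * s \<le> 1 * s" using \<delta>01 s0 by (intro mult_right_mono) auto
      then show ?thesis using s by linarith
    qed
    have kappa: "c \<le> real m * q"
    proof -
      have "x powr (1/3) * q = c * (x powr (1/3) * x powr (-1/3))" by (simp add: q_def)
      also have "x powr (1/3) * x powr (-1/3) = 1" using x by (simp add: powr_add[symmetric])
      finally have "c = x powr (1/3) * q" by simp
      also have "\<dots> \<le> real m * q" using m q0 by (intro mult_right_mono) auto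
      finally show ?thesis .
    qed
    have Lnn: "0 \<le> ?L x" using lx by linarith
    have l2: "(real l)\<^sup>2 \<le> (?L x)\<^sup>2" using l by (intro power_mono) auto
    define Q where "Q = 1 / (24 * K * (real l)\<^sup>2)"
    have "1 - ?P n \<le> real n ^ 4 * (exp (- (q\<^sup>2 * real u / 8))
           + 2 * real k * exp (- (q\<^sup>2 * (1 - q) ^ k) * real (n - 4 - u) * \<delta>\<^sup>2 / 2) + exp (- (Q\<^sup>2 * real k)))
     + real n ^ 3 * (2 * exp (- (q\<^sup>2 * real u / 8)) + exp (- (q * (real k)\<^sup>2)))"
      unfolding Q_def
    proof (rule prob_not_simply_connected_le[OF q0 e(7) _ un _ _ \<delta>01(1) _ K _ l1])
      show "p n \<le> 1" using assms(2)[of n] by simp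
      show "real k \<le> q\<^sup>2 * real u / 2" using k(1) e(3) qu by linarith
      show "real m \<le> (1 - \<delta>) * (q\<^sup>2 * (1 - q) ^ k) * real (n - 4 - u)"
        using m(2) s by (simp add: s_def mult.assoc)
      show "1 < real m * q" using kappa c by linarith
      show "2 * (real m * q) \<le> K * (real m * q - 1)"
        using kappa c by (simp add: K_def field_simps)
      show "4 * K * (real l)\<^sup>2 * q \<le> 1"
      proof -
        have "4 * K * (real l)\<^sup>2 * q \<le> 4 * K * (?L x)\<^sup>2 * q"
          using l2 K q0 by (intro mult_right_mono mult_left_mono) auto
        then show ?thesis using e(5) by linarith
      qed
      show "1 \<le> q * (real m * q) ^ l"
      proof -
        \<comment> \<open>The length is chosen such that \<open>c ^ l \<ge> x\<close>.\<close>
        have "x = c powr (ln x / ln c)" using x c lnc by (simp add: powr_def)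
        also have "\<dots> \<le> c powr real l" using l c by (intro powr_mono) auto
        also have "\<dots> = c ^ l" using c by (simp add: powr_realpow)
        also have "\<dots> \<le> (real m * q) ^ l" using kappa c by (intro power_mono) auto
        finally have "x \<le> (real m * q) ^ l" .
        then have "q * x \<le> q * (real m * q) ^ l" using q0 by (intro mult_left_mono) auto
        moreover have "1 \<le> q * x"
        proof -
          have "1 \<le> x powr (2/3)" using x by (intro ge_one_powr_ge_zero) auto
          also have "\<dots> = x powr (-1/3) * x" using x powr_add[of x "-1/3" 1] by simp
          also have "\<dots> \<le> q * x" using qge x by (intro mult_right_mono) auto
          finally show ?thesis .
        qed
        ultimately show ?thesis by linarith
      qed
      show "2 * l\<^sup>2 \<le> m"
      proof -
        have "2 * (real l)\<^sup>2 \<le> real m" using l2 e(6) m(1) by linarith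
        then show ?thesis by (metis of_nat_le_iff of_nat_mult of_nat_numeral of_nat_power)
      qed
    qed
    also have "\<dots> \<le> ?G x"
    proof -
      have b1: "exp (- (q\<^sup>2 * real u / 8)) \<le> exp (- (x powr (-2/3) * (x powr (19/20) - 1) / 8))"
        using qu by simp
      have b2: "real k * exp (- (q\<^sup>2 * (1 - q) ^ k) * real (n - 4 - u) * \<delta>\<^sup>2 / 2) \<le> x powr (1/4) * exp (- (x powr (2/15) / 2))"
      proof (intro mult_mono k)
        have "x powr (2/15) = x powr (1/3) * \<delta>\<^sup>2"
          using x by (simp add: \<delta>_def powr_power powr_add[symmetric])
        also have "\<dots> \<le> s * \<delta>\<^sup>2" using sge by (intro mult_right_mono) auto
        finally show "exp (- (q\<^sup>2 * (1 - q) ^ k) * real (n - 4 - u) * \<delta>\<^sup>2 / 2) \<le> exp (- (x powr (2/15) / 2))"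
          by (simp add: s_def)
      qed auto
      have b3: "exp (- (Q\<^sup>2 * real k)) \<le> exp (- ((x powr (1/4) - 1) / (24 * K * (?L x)\<^sup>2)\<^sup>2))"
      proof -
        have "1 / (24 * K * (?L x)\<^sup>2) \<le> Q"
          unfolding Q_def
        proof (rule frac_le)
          show "0 < 24 * K * (real l)\<^sup>2" using K0 l1 by simp
          show "24 * K * (real l)\<^sup>2 \<le> 24 * K * (?L x)\<^sup>2" using l2 K0 by simp
        qed simp_all
        then have "(1 / (24 * K * (?L x)\<^sup>2))\<^sup>2 \<le> Q\<^sup>2" using K by (intro power_mono) auto
        then have "(1 / (24 * K * (?L x)\<^sup>2))\<^sup>2 * (x powr (1/4) - 1) \<le> Q\<^sup>2 * real k"
          using k x ge_one_powr_ge_zero[of x "1/4"] by (intro mult_mono) auto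
        then show ?thesis by (simp add: power_divide)
      qed
      have b4: "exp (- (q * (real k)\<^sup>2)) \<le> exp (- (x powr (-1/3) * (x powr (1/4) - 1)\<^sup>2))"
      proof -
        have "(x powr (1/4) - 1)\<^sup>2 \<le> (real k)\<^sup>2"
          using k x ge_one_powr_ge_zero[of x "1/4"] by (intro power_mono) auto
        then have "x powr (-1/3) * (x powr (1/4) - 1)\<^sup>2 \<le> q * (real k)\<^sup>2"
          using qge q0 by (intro mult_mono) auto
        then show ?thesis by simp
      qed
      show ?thesis
        unfolding x_def[symmetric] mult.assoc[of 2]
        using x by (intro add_mono mult_left_mono b1 b2 b3 b4) auto
    qed
    finally show ?case by (simp add: x_def)
  qed
  have lim: "(\<lambda>n. ?G (real n)) \<longlonglongrightarrow> 0"
    using filterlim_compose[OF union_bound_vanishes[OF lnc K0] filterlim_real_sequentially] .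
  have lower: "\<forall>\<^sub>F n in sequentially. 0 \<le> 1 - ?P n"
    by (rule always_eventually, rule allI, simp only: diff_ge_0_iff_ge measure_pmf.prob_le_1)
  have "(\<lambda>n. 1 - ?P n) \<longlonglongrightarrow> 0"
    by (rule tendsto_sandwich[OF lower upper tendsto_const lim])
  then have "(\<lambda>n. 1 - (1 - ?P n)) \<longlonglongrightarrow> 1 - 0" by (intro tendsto_diff tendsto_const)
  then show ?thesis by simp
qed

end
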